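(* Assume: (A 1) $G(\theta,\cdot)$ is Borel measurable for every $\theta\in\Theta$; (A 2) there is a strictly positive, Borel measurable, $\mathbb{P}^{Z}$-integrable mapping $\xi:\mathbb{R}^{d}\to\mathbb{R}$ with $\sup_{\theta\in\Theta}|G(\theta,z)|\le\xi(z)$ for all $z\in\mathbb{R}^{d}$; (A 3) there exist an at most countable subset $\overline{\Theta}\subseteq\Theta$ and $(\mathbb{P}^{Z})^{n}$-null sets $N_{n}$ ($n\in\mathbb{N}$) such that $$\inf_{\vartheta\in\overline{\Theta}}\big|\mathbb{E}[G(\vartheta,Z_{1})]-\mathbb{E}[G(\theta,Z_{1})]\big|=\inf_{\vartheta\in\overline{\Theta}}\max_{j\in\{1,\dots,n\}}|G(\theta,z_{j})-G(\vartheta,z_{j})|=0$$ for all $n\in\mathbb{N}$, $\theta\in\Theta$ and $(z_{1},\dots,z_{n})\in\mathbb{R}^{dn}\setminus N_{n}$. Suppose $\xi$ from (A 2) is square $\mathbb{P}^{Z}$-integrable. If $J(\mathbb{F}^{\Theta},\xi,1/2)$ is finite, then the sequence $$\Big(\sqrt n\Big[\inf_{\theta\in\Theta}\frac1n\sum_{j=1}^{n}G(\theta,Z_{j})-\inf_{\theta\in\Theta}\mathbb{E}[G(\theta,Z_{1})]\Big]\Big)_{n\in\mathbb{N}}$$ is uniformly tight.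
   Context: Let $m,d\in\mathbb{N}$, let $\Theta\subseteq\mathbb{R}^{m}$ be nonempty and compact, let $(\Omega,\mathcal{F},\mathbb{P})$ be an atomless complete probability space, and let $(Z_{j})_{j\in\mathbb{N}}$ be i.i.d. $d$-dimensional random vectors on it with common distribution $\mathbb{P}^{Z}$. Let $G:\Theta\times\mathbb{R}^{d}\to\mathbb{R}$ and $\mathbb{F}^{\Theta}:=\{G(\theta,\cdot)\mid\theta\in\Theta\}$. For a probability measure $\mathbb{Q}$ on $\mathcal{B}(\mathbb{R}^{d})$, $\|\cdot\|_{\mathbb{Q},2}$ is the $L^{2}(\mathbb{Q})$-norm. For a nonempty set $\mathbb{F}$ of Borel measurable functions $\mathbb{R}^{d}\to\mathbb{R}$, $N(\eta,\mathbb{F},L^{2}(\mathbb{Q}))$ is the minimal number of closed $L^{2}(\mathbb{Q})$-balls of radius $\eta>0$ with centers in $\mathbb{F}$ needed to cover $\mathbb{F}$ ($\infty$ if there is no finite cover). $\mathcal{M}_{\mathrm{fin}}$ is the set of probability measures on $\mathcal{B}(\mathbb{R}^{d})$ with finite support. For a Borel measurable strictly positive $C_{\mathbb{F}}$ with $\sup_{h\in\mathbb{F}}|h|\le C_{\mathbb{F}}$ (positive envelope), $$J(\mathbb{F},C_{\mathbb{F}},\delta):=\int_{0}^{\delta}\sup_{\mathbb{Q}\in\mathcal{M}_{\mathrm{fin}}}\sqrt{\ln\big(2N(\varepsilon\|C_{\mathbb{F}}\|_{\mathbb{Q},2},\mathbb{F},L^{2}(\mathbb{Q}))\big)}\,d\varepsilon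 .$$ *)

theory Defs
  imports "HOL-Probability.Probability"
begin

definition atomless :: "'w measure \<Rightarrow> bool" where
  "atomless M \<longleftrightarrow>
     (\<forall>A\<in>sets M. 0 < emeasure M A \<longrightarrow>
        (\<exists>B\<in>sets M. B \<subseteq> A \<and> 0 < emeasure M B \<and> emeasure M B < emeasure M A))"

text \<open>The \<open>L\<^sup>2(Q)\<close>-norm with values in \<open>[0, \<infinity>]\<close>: it is \<open>\<infinity>\<close> (and not a junk
  value) if the function is not square integrable.\<close>

definition L2_norm :: "'a measure \<Rightarrow> ('a \<Rightarrow> real) \<Rightarrow> ennreal" where
  "L2_norm Q f =
     (let I = (\<integral>\<^sup>+ x. ennreal ((f x)\<^sup>2) \<partial>Q)
      in if I = \<infinity> then \<infinity> else ennreal (sqrt (enn2real I)))"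

text \<open>An infimum over the empty set in \<open>enat\<close> is \<open>\<infinity>\<close>, so that this is \<open>\<infinity>\<close> if there is no
  finite cover.\<close>

definition covering_number :: "ennreal \<Rightarrow> ('a \<Rightarrow> real) set \<Rightarrow> 'a measure \<Rightarrow> enat" where
  "covering_number \<eta> F Q =
     (INF S \<in> {S. finite S \<and> S \<subseteq> F \<and> (\<forall>h\<in>F. \<exists>c\<in>S. L2_norm Q (\<lambda>x. h x - c x) \<le> \<eta>)}.
        enat (card S))"

definition M_fin :: "'a::topological_space measure set" where
  "M_fin = {Q. prob_space Q \<and> sets Q = sets borel \<and> (\<exists>S. finite S \<and> (AE x in Q. x \<in> S))}"

text \<open>\<open>sqrt (ln (2 * N))\<close> for \<open>N\<close> in \<open>\<nat> \<union> {\<infinity>}\<close>.\<close>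

definition sqrt_ln_twice :: "enat \<Rightarrow> ennreal" where
  "sqrt_ln_twice N = (case N of enat k \<Rightarrow> ennreal (sqrt (ln (2 * real k))) | \<infinity> \<Rightarrow> \<infinity>)"

definition entropy_integral ::
    "('a::topological_space \<Rightarrow> real) set \<Rightarrow> ('a \<Rightarrow> real) \<Rightarrow> real \<Rightarrow> ennreal" where
  "entropy_integral F C \<delta> =
     (\<integral>\<^sup>+ \<epsilon> \<in> {0<..\<delta>}.
        (SUP Q \<in> M_fin. sqrt_ln_twice (covering_number (ennreal \<epsilon> * L2_norm Q C) F Q)) \<partial>lborel)"

text \<open>\<open>tight\<close> is a property of the laws, which are only meaningful for measurable functions.\<close>

definition uniformly_tight :: "'w measure \<Rightarrow> (nat \<Rightarrow> 'w \<Rightarrow> real) \<Rightarrow> bool" where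
  "uniformly_tight M X \<longleftrightarrow>
     (\<forall>n. X n \<in> borel_measurable M) \<and> tight (\<lambda>n. distr M borel (X n))"

end

theory Submission
  imports Defs
begin

text \<open>By (A 3) both infima may be taken over a countable subset of \<open>\<Theta>\<close> almost surely, so the
  \<open>n\<close>-th term is dominated by the supremum of the empirical process over that subset; it is
  enough to bound the expectation of this supremum uniformly in \<open>n\<close> and to apply Markov's
  inequality. Symmetrization replaces the centred sums by Rademacher sums. For a fixed sample, Dudley's
  chaining in the \<open>L\<^sup>2\<close>-space of the empirical measure, which has finite support, bounds these by
  \<open>(\<Sum>j. \<xi> (Z j)\<^sup>2) powr (1/2)\<close> times a constant depending on the entropy integral only, and
  square integrability of \<open>\<xi>\<close> makes this of order \<open>sqrt n\<close>.\<close>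

section \<open>Rademacher sums\<close>

text \<open>The sample, and with it the norm used for chaining, is random; this is why the entropy
  integral takes a supremum over all finitely supported measures. The nets may then depend on the
  sample, while the resulting bound depends on it only through the empirical norm of
  \<open>\<xi>\<close>. Two obstacles shape the argument. Suprema over \<open>\<Theta>\<close> need
  not be measurable, whereas the centres of the nets lie in the full class and not necessarily in
  its countable part. Hence chaining is done for one fixed sample over the full class, where only
  finite sums over sign vectors occur, and the supremum is restricted to the countable set before
  the sample is integrated. Nor is integrability of the supremum known beforehand, so suprema and
  expectations take values in \<open>ennreal\<close>. The scales start at \<open>1 / 2\<close>
  because the entropy integral ends there: the net of level \<open>k\<close> has radius
  \<open>1 / 2 ^ Suc k\<close> times the norm of the envelope, and level 0 needs no coarser net, as
  its members are dominated by the envelope itself.\<close>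

text \<open>Rademacher averages occur as unnormalised sums over all sign vectors in
  \<open>PiE I (\<lambda>_. {- 1, 1})\<close>, hence the factors \<open>2 ^ card I\<close>.\<close>

lemma exp_sum_le_exp_square:
  fixes x :: real
  shows "exp x + exp (- x) \<le> 2 * exp (x\<^sup>2 / 2)"
proof -
  \<comment> \<open>Hoeffding's lemma for a fair sign: the range has length 2, so the exponent is
    y^2 * 2^2 / 8. It asks for a positive parameter; evenness covers negative
    \<open>x\<close>.\<close>
  have *: "exp y + exp (- y) \<le> 2 * exp (y\<^sup>2 / 2)" if "y > 0" for y :: real
  proof -
    interpret interval_bounded_random_variable "measure_pmf (pmf_of_set {-1, 1 :: real})" "\<lambda>x. x" "-1" 1
      by unfold_locales (auto simp: AE_measure_pmf_iff)
    have "measure_pmf.expectation (pmf_of_set {-1, 1 :: real}) (\<lambda>x. x) = 0"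
      by (subst integral_pmf_of_set) auto
    from Hoeffdings_lemma_nn_integral_0[OF that this]
    have "(\<integral>\<^sup>+ x. ennreal (exp (y * x)) \<partial>pmf_of_set {-1, 1 :: real}) \<le> ennreal (exp (y\<^sup>2 / 2))"
      by simp
    moreover have "(\<integral>\<^sup>+ x. ennreal (exp (y * x)) \<partial>pmf_of_set {-1, 1 :: real})
        = ennreal ((exp y + exp (- y)) / 2)"
      by (subst nn_integral_pmf_of_set) (auto simp flip: ennreal_plus ennreal_numeral simp add: divide_ennreal add.commute)
    ultimately show ?thesis
      by (simp add: ennreal_le_iff)
  qed
  consider "x > 0" | "x = 0" | "- x > 0" by linarith
  then show ?thesis
    using *[of x] *[of "- x"] by cases auto
qed

text \<open>Conditioning on one sign; the inductions for the exponential moment and for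
  symmetrization both peel off a coordinate this way.\<close>

lemma sum_PiE_insert_signs:
  fixes f :: "('i \<Rightarrow> real) \<Rightarrow> 'b :: comm_monoid_add"
  assumes "finite I" "i \<notin> I"
  shows "(\<Sum>s\<in>PiE (insert i I) (\<lambda>_. {- 1, 1}). f s) =
    (\<Sum>s\<in>PiE I (\<lambda>_. {- 1, 1}). f (s(i := 1)) + f (s(i := - 1)))"
proof -
  have inj: "inj_on (\<lambda>(y, g). g(i := y)) ({- 1, 1 :: real} \<times> PiE I (\<lambda>_. {- 1, 1}))"
    using assms(2) by (auto simp: inj_on_def fun_eq_iff PiE_def extensional_def) metis+
  have "(\<Sum>s\<in>PiE (insert i I) (\<lambda>_. {- 1, 1}). f s)
      = (\<Sum>(y, g)\<in>{- 1, 1 :: real} \<times> PiE I (\<lambda>_. {- 1, 1}). f (g(i := y)))"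
    unfolding PiE_insert_eq by (subst sum.reindex[OF inj]) (simp add: case_prod_unfold o_def)
  also have "\<dots> = (\<Sum>y\<in>{- 1, 1}. \<Sum>g\<in>PiE I (\<lambda>_. {- 1, 1}). f (g(i := y)))"
    by (simp only: sum.cartesian_product)
  also have "\<dots> = (\<Sum>s\<in>PiE I (\<lambda>_. {- 1, 1}). f (s(i := 1)) + f (s(i := - 1)))"
    by (simp add: sum.distrib add.commute)
  finally show ?thesis .
qed

lemma card_PiE_signs: "finite I \<Longrightarrow> card (PiE I (\<lambda>_. {- 1, 1 :: real})) = 2 ^ card I"
  by (simp add: card_PiE numeral_2_eq_2)

text \<open>Sub-Gaussianity of Rademacher sums: the exponential factorises over the coordinates, and
  \<open>exp_sum_le_exp_square\<close> bounds each factor.\<close>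

lemma sum_signs_exp_le:
  fixes a :: "'i \<Rightarrow> real"
  assumes "finite I"
  shows "(\<Sum>s\<in>PiE I (\<lambda>_. {- 1, 1}). exp (\<Sum>j\<in>I. s j * a j)) \<le> 2 ^ card I * exp ((\<Sum>j\<in>I. (a j)\<^sup>2) / 2)"
  using assms
proof (induction I)
  case empty
  then show ?case by simp
next
  case (insert i I)
  have *: "(\<Sum>j\<in>I. (s(i := t)) j * a j) = (\<Sum>j\<in>I. s j * a j)" for s t
    using insert by (intro sum.cong) auto
  have "(\<Sum>s\<in>PiE (insert i I) (\<lambda>_. {- 1, 1}). exp (\<Sum>j\<in>insert i I. s j * a j))
      = (\<Sum>s\<in>PiE I (\<lambda>_. {- 1, 1}). (exp (a i) + exp (- a i)) * exp (\<Sum>j\<in>I. s j * a j))"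
    using insert by (simp add: sum_PiE_insert_signs * exp_add distrib_right del: fun_upd_apply) (simp add: fun_upd_def)
  also have "\<dots> \<le> (2 * exp ((a i)\<^sup>2 / 2)) * (2 ^ card I * exp ((\<Sum>j\<in>I. (a j)\<^sup>2) / 2))"
    unfolding sum_distrib_left[symmetric]
    by (intro mult_mono insert.IH exp_sum_le_exp_square sum_nonneg) auto
  also have "\<dots> = 2 ^ card (insert i I) * exp ((\<Sum>j\<in>insert i I. (a j)\<^sup>2) / 2)"
    using insert by (simp add: add_divide_distrib exp_add)
  finally show ?case .
qed

text \<open>The elementary inequality \<open>y \<le> exp (y - b) + b - 1\<close> replaces Jensen's inequality for the
  logarithm; the bound follows with \<open>b = \<lambda>\<^sup>2 r\<^sup>2 / 2 + ln (2 N)\<close> and the optimal \<open>\<lambda>\<close>.\<close>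

lemma rademacher_maximal_inequality:
  fixes v :: "'f \<Rightarrow> 'i \<Rightarrow> real"
  assumes I: "finite I" and A: "finite A" "A \<noteq> {}" and r: "r \<ge> 0"
    and le: "\<And>f. f \<in> A \<Longrightarrow> (\<Sum>j\<in>I. (v f j)\<^sup>2) \<le> r\<^sup>2"
  shows "(\<Sum>s\<in>PiE I (\<lambda>_. {- 1, 1}). Max ((\<lambda>f. \<bar>\<Sum>j\<in>I. s j * v f j\<bar>) ` A))
    \<le> 2 ^ card I * (r * sqrt 2 * sqrt (ln (2 * card A)))"
proof (cases "r = 0")
  case True
  have "(\<Sum>j\<in>I. (v f j)\<^sup>2) = 0" if "f \<in> A" for f
    using le[OF that] True by (intro antisym sum_nonneg) auto
  then have "v f j = 0" if "f \<in> A" "j \<in> I" for f j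
    using that I by (simp add: sum_nonneg_eq_0_iff)
  then have "(\<lambda>f. \<bar>\<Sum>j\<in>I. s j * v f j\<bar>) ` A = {0}" for s
    using A(2) by auto
  then show ?thesis
    using True by simp
next
  case False
  let ?S = "PiE I (\<lambda>_. {- 1, 1 :: real})"
  define R where "R s f = (\<Sum>j\<in>I. s j * v f j)" for s f
  define L where "L = ln (2 * real (card A))"
  have cA: "card A \<ge> 1"
    using A by (simp add: Suc_leI card_gt_0_iff)
  have L: "L > 0"
    unfolding L_def using cA by (intro ln_gt_zero) simp
  \<comment> \<open>This value minimises \<open>b / l\<close>: it makes the two summands of
    \<open>b\<close> equal.\<close>
  define l where "l = sqrt (2 * L) / r"
  have l: "l > 0"
    using L False r by (simp add: l_def)
  have l2: "l\<^sup>2 * r\<^sup>2 = 2 * L"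
    using False L by (simp add: l_def power_divide)
  define b where "b = l\<^sup>2 * r\<^sup>2 / 2 + L"
  have b: "b = 2 * L"
    by (simp add: b_def l2)
  have exp_b: "exp b = exp (l\<^sup>2 * r\<^sup>2 / 2) * (2 * card A)"
    using cA by (simp add: b_def exp_add L_def)
  have max_le: "l * Max ((\<lambda>f. \<bar>R s f\<bar>) ` A) \<le> b - 1 + (\<Sum>f\<in>A. exp (l * R s f) + exp (- (l * R s f))) / exp b" for s
  proof -
    have "Max ((\<lambda>f. \<bar>R s f\<bar>) ` A) \<in> (\<lambda>f. \<bar>R s f\<bar>) ` A"
      using A by (intro Max_in) auto
    then obtain f where f: "f \<in> A" "Max ((\<lambda>f. \<bar>R s f\<bar>) ` A) = \<bar>R s f\<bar>"
      by auto
    have "l * \<bar>R s f\<bar> \<le> b - 1 + exp (l * \<bar>R s f\<bar> - b)"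
      using exp_ge_add_one_self[of "l * \<bar>R s f\<bar> - b"] by linarith
    also have "exp (l * \<bar>R s f\<bar> - b) = exp (l * \<bar>R s f\<bar>) / exp b"
      by (rule exp_diff)
    also have "exp (l * \<bar>R s f\<bar>) \<le> exp (l * R s f) + exp (- (l * R s f))"
      by (cases "R s f \<ge> 0") auto
    also have "\<dots> \<le> (\<Sum>f\<in>A. exp (l * R s f) + exp (- (l * R s f)))"
      using A f by (intro member_le_sum) auto
    finally show ?thesis
      by (simp add: f divide_right_mono)
  qed
  have sum_exp: "(\<Sum>s\<in>?S. exp (c * R s f)) \<le> 2 ^ card I * exp (l\<^sup>2 * r\<^sup>2 / 2)"
    if "f \<in> A" "c = l \<or> c = - l" for f c
  proof -
    have c2: "c\<^sup>2 = l\<^sup>2"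
      using that(2) by auto
    have "(\<Sum>s\<in>?S. exp (c * R s f)) = (\<Sum>s\<in>?S. exp (\<Sum>j\<in>I. s j * (c * v f j)))"
      by (simp add: R_def sum_distrib_left mult_ac)
    also have "\<dots> \<le> 2 ^ card I * exp ((\<Sum>j\<in>I. (c * v f j)\<^sup>2) / 2)"
      by (rule sum_signs_exp_le[OF I])
    also have "(\<Sum>j\<in>I. (c * v f j)\<^sup>2) = l\<^sup>2 * (\<Sum>j\<in>I. (v f j)\<^sup>2)"
      by (simp add: power_mult_distrib c2 sum_distrib_left)
    also have "l\<^sup>2 * (\<Sum>j\<in>I. (v f j)\<^sup>2) \<le> l\<^sup>2 * r\<^sup>2"
      using le[OF that(1)] by (intro mult_left_mono) auto
    finally show ?thesis by simp
  qed
  have "l * (\<Sum>s\<in>?S. Max ((\<lambda>f. \<bar>R s f\<bar>) ` A))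
      \<le> (\<Sum>s\<in>?S. b - 1 + (\<Sum>f\<in>A. exp (l * R s f) + exp (- (l * R s f))) / exp b)"
    unfolding sum_distrib_left by (intro sum_mono max_le)
  also have "\<dots> = 2 ^ card I * (b - 1) +
      (\<Sum>f\<in>A. (\<Sum>s\<in>?S. exp (l * R s f)) + (\<Sum>s\<in>?S. exp (- l * R s f))) / exp b"
    by (simp add: sum.distrib sum_subtractf card_PiE_signs[OF I] sum_divide_distrib[symmetric]
        sum.swap[of _ A] right_diff_distrib)
  also have "\<dots> \<le> 2 ^ card I * (b - 1) +
      (\<Sum>f\<in>A. 2 ^ card I * exp (l\<^sup>2 * r\<^sup>2 / 2) + 2 ^ card I * exp (l\<^sup>2 * r\<^sup>2 / 2)) / exp b"
    by (intro add_left_mono divide_right_mono sum_mono add_mono sum_exp) auto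
  \<comment> \<open>By \<open>exp_b\<close> the exponential sum is exactly
    \<open>2 ^ card I\<close>, which cancels the \<open>- 1\<close>. The factor 2 inside the
    logarithm pays for the two signs of \<open>R s f\<close>.\<close>
  also have "\<dots> = 2 ^ card I * b"
    using cA by (simp add: exp_b field_simps)
  finally have "(\<Sum>s\<in>?S. Max ((\<lambda>f. \<bar>R s f\<bar>) ` A)) \<le> 2 ^ card I * b / l"
    using l by (simp add: field_simps)
  also have "2 ^ card I * b / l = 2 ^ card I * (r * sqrt 2 * sqrt L)"
    using L by (simp add: b l_def real_sqrt_mult field_simps)
  finally show ?thesis
    by (simp add: R_def L_def)
qed

text \<open>Every point of level \<open>Suc K\<close> has a single parent \<open>p f\<close> in
  level \<open>K\<close>, so there are at most \<open>card (S (Suc K))\<close> links rather than the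
  product of both cardinalities. The maximal inequality applies to the links with radius
  \<open>r / 2 ^ Suc K\<close>, and the parents are left to the induction hypothesis.\<close>

lemma rademacher_chaining:
  fixes v :: "'f \<Rightarrow> 'i \<Rightarrow> real" and S :: "nat \<Rightarrow> 'f set"
  assumes I: "finite I" and S: "\<And>k. finite (S k)" "\<And>k. S k \<noteq> {}" and r: "r \<ge> 0"
    and base: "\<And>f. f \<in> S 0 \<Longrightarrow> (\<Sum>j\<in>I. (v f j)\<^sup>2) \<le> r\<^sup>2"
    and link: "\<And>k f. f \<in> S (Suc k) \<Longrightarrow> \<exists>g\<in>S k. (\<Sum>j\<in>I. (v f j - v g j)\<^sup>2) \<le> (r / 2 ^ Suc k)\<^sup>2"
  shows "(\<Sum>s\<in>PiE I (\<lambda>_. {- 1, 1}). Max ((\<lambda>f. \<bar>\<Sum>j\<in>I. s j * v f j\<bar>) ` S K))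
    \<le> 2 ^ card I * (r * sqrt 2 * (\<Sum>k\<le>K. sqrt (ln (2 * card (S k))) / 2 ^ k))"
proof (induction K)
  case 0
  show ?case
    using rademacher_maximal_inequality[OF I S(1) S(2) r base] by simp
next
  case (Suc K)
  let ?\<Sigma> = "PiE I (\<lambda>_. {- 1, 1 :: real})"
  define R where "R s u = \<bar>\<Sum>j\<in>I. s j * u j\<bar>" for s u :: "'i \<Rightarrow> real"
  define p where "p f = (SOME g. g \<in> S K \<and> (\<Sum>j\<in>I. (v f j - v g j)\<^sup>2) \<le> (r / 2 ^ Suc K)\<^sup>2)" for f
  have p: "p f \<in> S K" "(\<Sum>j\<in>I. (v f j - v (p f) j)\<^sup>2) \<le> (r / 2 ^ Suc K)\<^sup>2" if "f \<in> S (Suc K)" for f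
    using someI_ex[of "\<lambda>g. g \<in> S K \<and> (\<Sum>j\<in>I. (v f j - v g j)\<^sup>2) \<le> (r / 2 ^ Suc K)\<^sup>2"] link[OF that]
    by (auto simp: p_def)
  define w where "w f j = v f j - v (p f) j" for f j
  have "(\<Sum>s\<in>?\<Sigma>. Max ((\<lambda>f. R s (v f)) ` S (Suc K)))
      \<le> (\<Sum>s\<in>?\<Sigma>. Max ((\<lambda>f. R s (v f)) ` S K) + Max ((\<lambda>f. R s (w f)) ` S (Suc K)))"
  proof (intro sum_mono Max.boundedI; (clarsimp simp: S)?)
    fix s f assume f: "f \<in> S (Suc K)"
    have "R s (v f) \<le> R s (v (p f)) + R s (w f)"
      unfolding R_def w_def by (simp add: right_diff_distrib sum_subtractf)
    also have "\<dots> \<le> Max ((\<lambda>f. R s (v f)) ` S K) + Max ((\<lambda>f. R s (w f)) ` S (Suc K))"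
      using S p f by (intro add_mono Max_ge) auto
    finally show "R s (v f) \<le> Max ((\<lambda>f. R s (v f)) ` S K) + Max ((\<lambda>f. R s (w f)) ` S (Suc K))" .
  qed
  also have "\<dots> \<le> 2 ^ card I * (r * sqrt 2 * (\<Sum>k\<le>K. sqrt (ln (2 * card (S k))) / 2 ^ k))
      + 2 ^ card I * (r / 2 ^ Suc K * sqrt 2 * sqrt (ln (2 * card (S (Suc K)))))"
    unfolding sum.distrib R_def using r
    by (intro add_mono Suc.IH rademacher_maximal_inequality I S p(2)[folded w_def]) auto
  also have "\<dots> = 2 ^ card I * (r * sqrt 2 * (\<Sum>k\<le>Suc K. sqrt (ln (2 * card (S k))) / 2 ^ k))"
    by (simp add: field_simps)
  finally show ?case
    by (simp add: R_def)
qed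

text \<open>A net of scale \<open>2 ^ - n\<close> already approximates all of \<open>F\<close> to within the target order \<open>r\<close>,
  since a Rademacher sum has only \<open>n\<close> terms; hence finitely many chaining steps suffice.\<close>

lemma rademacher_entropy_bound:
  fixes v :: "'f \<Rightarrow> 'i \<Rightarrow> real" and S :: "nat \<Rightarrow> 'f set"
  assumes I: "finite I" and S: "\<And>k. finite (S k)" "\<And>k. S k \<noteq> {}" "\<And>k. S k \<subseteq> F" and r: "r \<ge> 0"
    and bound: "\<And>f. f \<in> F \<Longrightarrow> (\<Sum>j\<in>I. (v f j)\<^sup>2) \<le> r\<^sup>2"
    and net: "\<And>k f. f \<in> F \<Longrightarrow> \<exists>g\<in>S k. (\<Sum>j\<in>I. (v f j - v g j)\<^sup>2) \<le> (r / 2 ^ Suc k)\<^sup>2"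
    and D: "\<And>K. (\<Sum>k\<le>K. sqrt (ln (2 * card (S k))) / 2 ^ k) \<le> D"
  shows "(\<Sum>s\<in>PiE I (\<lambda>_. {- 1, 1}). SUP f\<in>F. ennreal \<bar>\<Sum>j\<in>I. s j * v f j\<bar>)
    \<le> ennreal (2 ^ card I * (r * (sqrt 2 * D + 1)))"
proof -
  let ?\<Sigma> = "PiE I (\<lambda>_. {- 1, 1 :: real})"
  define n where "n = card I"
  have le: "\<bar>\<Sum>j\<in>I. s j * v f j\<bar> \<le> Max ((\<lambda>f. \<bar>\<Sum>j\<in>I. s j * v f j\<bar>) ` S n) + r"
    if s: "s \<in> ?\<Sigma>" and f: "f \<in> F" for s f
  proof -
    obtain g where g: "g \<in> S n" "(\<Sum>j\<in>I. (v f j - v g j)\<^sup>2) \<le> (r / 2 ^ Suc n)\<^sup>2"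
      using net[OF f] by blast
    have summand: "\<bar>s j * (v f j - v g j)\<bar> \<le> r / 2 ^ Suc n" if "j \<in> I" for j
    proof -
      have "(v f j - v g j)\<^sup>2 \<le> (\<Sum>j\<in>I. (v f j - v g j)\<^sup>2)"
        using I that by (intro member_le_sum) auto
      also note g(2)
      finally have "\<bar>v f j - v g j\<bar> \<le> r / 2 ^ Suc n"
        using r by (simp add: abs_le_square_iff[symmetric])
      moreover have "\<bar>s j\<bar> = 1"
        using s that by (auto simp: PiE_def Pi_def)
      ultimately show ?thesis
        by (simp add: abs_mult)
    qed
    have "\<bar>\<Sum>j\<in>I. s j * (v f j - v g j)\<bar> \<le> (\<Sum>j\<in>I. r / 2 ^ Suc n)"
      by (intro order_trans[OF sum_abs] sum_mono summand)
    also have "\<dots> = r * (n / 2 ^ Suc n)"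
      by (simp add: n_def)
    also have "real n \<le> 2 ^ Suc n"
      using of_nat_less_two_power[of n, where 'a = real] by (simp add: less_imp_le order_trans[of _ "2 ^ n"])
    then have "r * (n / 2 ^ Suc n) \<le> r * 1"
      using r by (intro mult_left_mono) auto
    finally have "\<bar>\<Sum>j\<in>I. s j * (v f j - v g j)\<bar> \<le> r" by simp
    moreover have "\<bar>\<Sum>j\<in>I. s j * v g j\<bar> \<le> Max ((\<lambda>f. \<bar>\<Sum>j\<in>I. s j * v f j\<bar>) ` S n)"
      using S g by (intro Max_ge) auto
    ultimately show ?thesis
      by (simp add: right_diff_distrib sum_subtractf)
  qed
  have Max_ge_0: "0 \<le> Max ((\<lambda>f. \<bar>\<Sum>j\<in>I. s j * v f j\<bar>) ` S n)" for s
  proof -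
    have "Max ((\<lambda>f. \<bar>\<Sum>j\<in>I. s j * v f j\<bar>) ` S n) \<in> (\<lambda>f. \<bar>\<Sum>j\<in>I. s j * v f j\<bar>) ` S n"
      using S by (intro Max_in) auto
    then show ?thesis by auto
  qed
  have "(\<Sum>s\<in>?\<Sigma>. SUP f\<in>F. ennreal \<bar>\<Sum>j\<in>I. s j * v f j\<bar>)
      \<le> (\<Sum>s\<in>?\<Sigma>. ennreal (Max ((\<lambda>f. \<bar>\<Sum>j\<in>I. s j * v f j\<bar>) ` S n) + r))"
    by (intro sum_mono SUP_least ennreal_leI le)
  also have "\<dots> = ennreal ((\<Sum>s\<in>?\<Sigma>. Max ((\<lambda>f. \<bar>\<Sum>j\<in>I. s j * v f j\<bar>) ` S n)) + 2 ^ card I * r)"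
    using Max_ge_0 r by (subst sum_ennreal) (auto simp: sum.distrib card_PiE_signs[OF I])
  also have "\<dots> \<le> ennreal (2 ^ card I * (r * sqrt 2 * D) + 2 ^ card I * r)"
    using r by (intro ennreal_leI add_right_mono mult_left_mono D
        order_trans[OF rademacher_chaining[OF I S(1,2) r bound]] net) (use S in \<open>auto simp: subset_iff\<close>)
  finally show ?thesis
    by (simp add: field_simps)
qed

section \<open>Dyadic sums and the entropy integral\<close>

text \<open>The dyadic step function is bounded pointwise by the integrand, so the integrand need not be
  known to be measurable.\<close>

lemma dyadic_sum_le_nn_integral:
  fixes h :: "real \<Rightarrow> ennreal"
  assumes mono: "\<And>x y. 0 < x \<Longrightarrow> x \<le> y \<Longrightarrow> y \<le> 1 / 2 \<Longrightarrow> h y \<le> h x"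
  shows "(\<Sum>k\<le>K. h (1 / 2 ^ Suc k) * ennreal (1 / 2 ^ k))
    \<le> 4 * (\<integral>\<^sup>+ x\<in>{0<..1 / 2}. h x \<partial>lborel)"
proof -
  \<comment> \<open>On \<open>B k\<close> the antitone integrand is at least its value at the right
    endpoint \<open>1 / 2 ^ Suc k\<close>. The length of \<open>B k\<close> is a quarter of
    \<open>1 / 2 ^ k\<close>, whence the factor 4.\<close>
  define B where "B k = {1 / 2 ^ Suc (Suc k)<..1 / 2 ^ Suc k :: real}" for k
  have pow: "1 / 2 ^ j \<le> (1 / 2 ^ i :: real)" if "i \<le> j" for i j :: nat
    using that by (intro divide_left_mono) auto
  have disj: "disjoint_family B"
  unfolding disjoint_family_on_def
  proof (intro ballI impI)
    have "B i \<inter> B j = {}" if "i < j" for i j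
      using pow[of "Suc (Suc i)" "Suc j"] that by (auto simp: B_def)
    then show "B i \<inter> B j = {}" if "i \<noteq> j" for i j
      using that by (metis Int_commute linorder_neqE_nat)
  qed
  have ind: "(\<Sum>k\<le>K. h (1 / 2 ^ Suc k) * indicator (B k) x) \<le> h x * indicator {0<..1 / 2} x" for x
  proof (cases "\<exists>k\<le>K. x \<in> B k")
    case True
    then obtain k where k: "k \<le> K" "x \<in> B k" by auto
    have "0 < (1 / 2 ^ Suc (Suc k) :: real)" "1 / 2 ^ Suc k \<le> (1 / 2 :: real)"
      using pow[of "Suc 0" "Suc k"] by simp_all
    then have x: "0 < x" "x \<le> 1 / 2" "x \<le> 1 / 2 ^ Suc k"
      using k(2) unfolding B_def greaterThanAtMost_iff by linarith+
    have "(\<Sum>k\<le>K. h (1 / 2 ^ Suc k) * indicator (B k) x) = (\<Sum>i\<in>{k}. h (1 / 2 ^ Suc i) * indicator (B i) x)"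
      using k disj by (intro sum.mono_neutral_right) (auto simp: disjoint_family_on_def indicator_def)
    also have "\<dots> = h (1 / 2 ^ Suc k)"
      using k by simp
    also have "\<dots> \<le> h x"
      using x pow[of "Suc 0" "Suc k"] by (intro mono) auto
    finally show ?thesis
      using x by simp
  next
    case False
    then have "(\<Sum>k\<le>K. h (1 / 2 ^ Suc k) * indicator (B k) x) = 0"
      by (intro sum.neutral) (auto simp: indicator_def)
    then show ?thesis
      by simp
  qed
  have len: "4 * emeasure lborel (B k) = ennreal (1 / 2 ^ k)" for k
  proof -
    have "emeasure lborel (B k) = ennreal (1 / 2 ^ Suc k - 1 / 2 ^ Suc (Suc k))"
      unfolding B_def by (intro emeasure_lborel_Ioc pow) simp
    also have "1 / 2 ^ Suc k - 1 / 2 ^ Suc (Suc k) = (1 / 2 ^ k / 4 :: real)"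
      by (simp add: field_simps)
    also have "4 * ennreal (1 / 2 ^ k / 4) = ennreal (4 * (1 / 2 ^ k / 4))"
      by (subst ennreal_mult') auto
    finally show ?thesis by simp
  qed
  have "(\<Sum>k\<le>K. h (1 / 2 ^ Suc k) * ennreal (1 / 2 ^ k)) = 4 * (\<Sum>k\<le>K. h (1 / 2 ^ Suc k) * emeasure lborel (B k))"
    unfolding sum_distrib_left len[symmetric] by (simp add: mult_ac)
  also have "(\<Sum>k\<le>K. h (1 / 2 ^ Suc k) * emeasure lborel (B k))
      = (\<integral>\<^sup>+ x. (\<Sum>k\<le>K. h (1 / 2 ^ Suc k) * indicator (B k) x) \<partial>lborel)"
    by (subst nn_integral_sum) (auto simp: nn_integral_cmult B_def)
  also have "\<dots> \<le> (\<integral>\<^sup>+ x\<in>{0<..1 / 2}. h x \<partial>lborel)"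
    by (intro nn_integral_mono ind)
  finally show ?thesis
    by (simp add: mult_left_mono)
qed

section \<open>Symmetrization\<close>

lemma borel_measurable_SUP_ennreal_abs:
  fixes u :: "'w \<Rightarrow> 't \<Rightarrow> real"
  assumes "countable T" and "\<And>t. t \<in> T \<Longrightarrow> (\<lambda>w. u w t) \<in> borel_measurable N"
  shows "(\<lambda>w. SUP t\<in>T. ennreal \<bar>u w t\<bar>) \<in> borel_measurable N"
  using assms by (intro borel_measurable_SUP) auto

text \<open>Since \<open>x + g z - E g\<close> is the midpoint of \<open>x + 2 g z\<close> and \<open>x - 2 E g\<close>, convexity
  of the supremum followed by Jensen's inequality on the second point suffices; no independent
  copy of \<open>z\<close> is needed.\<close>

lemma (in prob_space) symmetrization_step:
  fixes g :: "'t \<Rightarrow> 'a \<Rightarrow> real" and x :: "'t \<Rightarrow> real"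
  assumes T: "countable T" and g: "\<And>t. t \<in> T \<Longrightarrow> integrable M (g t)"
  shows "(\<integral>\<^sup>+ z. (SUP t\<in>T. ennreal \<bar>x t + (g t z - expectation (g t))\<bar>) \<partial>M)
    \<le> ((\<integral>\<^sup>+ z. (SUP t\<in>T. ennreal \<bar>x t + 2 * g t z\<bar>) \<partial>M)
       + (\<integral>\<^sup>+ z. (SUP t\<in>T. ennreal \<bar>x t - 2 * g t z\<bar>) \<partial>M)) / 2"
proof -
  have [measurable]: "g t \<in> borel_measurable M" if "t \<in> T" for t
    using g[OF that] by auto
  note [measurable] = borel_measurable_SUP[OF T]
  let ?P = "\<lambda>z. SUP t\<in>T. ennreal \<bar>x t + 2 * g t z\<bar>"
  let ?N = "\<integral>\<^sup>+ z. (SUP t\<in>T. ennreal \<bar>x t - 2 * g t z\<bar>) \<partial>M"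
  have jensen: "ennreal \<bar>x t - 2 * expectation (g t)\<bar> \<le> ?N" if t: "t \<in> T" for t
  proof -
    have "x t - 2 * expectation (g t) = expectation (\<lambda>z. x t - 2 * g t z)"
      using g[OF t] by (simp add: prob_space)
    also have "ennreal \<bar>\<dots>\<bar> \<le> (\<integral>\<^sup>+ z. ennreal \<bar>x t - 2 * g t z\<bar> \<partial>M)"
      using integral_norm_bound_ennreal[of M "\<lambda>z. x t - 2 * g t z"] g[OF t] by simp
    also have "\<dots> \<le> ?N"
      using t by (intro nn_integral_mono SUP_upper)
    finally show ?thesis .
  qed
  have "(SUP t\<in>T. ennreal \<bar>x t + (g t z - expectation (g t))\<bar>) \<le> (?P z + ?N) / 2" for z
  proof (rule SUP_least)
    fix t assume t: "t \<in> T"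
    have "\<bar>x t + (g t z - expectation (g t))\<bar>
        \<le> (\<bar>x t + 2 * g t z\<bar> + \<bar>x t - 2 * expectation (g t)\<bar>) / 2"
      by (auto simp: abs_if)
    then have "ennreal \<bar>x t + (g t z - expectation (g t))\<bar>
        \<le> ennreal ((\<bar>x t + 2 * g t z\<bar> + \<bar>x t - 2 * expectation (g t)\<bar>) / 2)"
      by (rule ennreal_leI)
    also have "\<dots> = (ennreal \<bar>x t + 2 * g t z\<bar> + ennreal \<bar>x t - 2 * expectation (g t)\<bar>) / 2"
      by (simp add: divide_ennreal flip: ennreal_plus ennreal_numeral)
    also have "\<dots> \<le> (?P z + ?N) / 2"
      by (intro divide_right_mono_ennreal add_mono SUP_upper jensen t)
    finally show "ennreal \<bar>x t + (g t z - expectation (g t))\<bar> \<le> (?P z + ?N) / 2" .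
  qed
  then have "(\<integral>\<^sup>+ z. (SUP t\<in>T. ennreal \<bar>x t + (g t z - expectation (g t))\<bar>) \<partial>M)
      \<le> (\<integral>\<^sup>+ z. (?P z + ?N) / 2 \<partial>M)"
    by (intro nn_integral_mono)
  also have "\<dots> = (nn_integral M ?P + ?N) / 2"
    by (simp add: nn_integral_divide nn_integral_add emeasure_space_1)
  finally show ?thesis .
qed

text \<open>The offset \<open>x\<close> is arbitrary so that the coordinates can be treated one by
  one: whatever the other coordinates contribute is absorbed into it. Each use of
  \<open>symmetrization_step\<close> turns one centred summand into a doubled summand with a fair
  sign.\<close>

lemma (in prob_space) symmetrization:
  fixes g :: "'t \<Rightarrow> 'a \<Rightarrow> real" and x :: "'t \<Rightarrow> real" and I :: "'i set"
  assumes T: "countable T" and g: "\<And>t. t \<in> T \<Longrightarrow> integrable M (g t)" and "finite I"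
  shows "(\<integral>\<^sup>+ z. (SUP t\<in>T. ennreal \<bar>x t + (\<Sum>j\<in>I. g t (z j) - expectation (g t))\<bar>) \<partial>PiM I (\<lambda>_. M))
    \<le> (\<Sum>s\<in>PiE I (\<lambda>_. {- 1, 1}).
        \<integral>\<^sup>+ z. (SUP t\<in>T. ennreal \<bar>x t + 2 * (\<Sum>j\<in>I. s j * g t (z j))\<bar>) \<partial>PiM I (\<lambda>_. M)) / 2 ^ card I"
  using \<open>finite I\<close>
proof (induction I arbitrary: x)
  case empty
  show ?case
    by (simp add: PiM_empty divide_ennreal_def)
next
  case (insert i I)
  interpret P: product_prob_space "\<lambda>_. M" I ..
  have gm [measurable]: "g t \<in> borel_measurable M" if "t \<in> T" for t
    using g[OF that] by auto
  define \<Phi> where "\<Phi> u = (SUP t\<in>T. ennreal \<bar>u t\<bar>)" for u :: "'t \<Rightarrow> real"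
  define D where "D z t = (\<Sum>j\<in>I. g t (z j) - expectation (g t))" for z t
  define R where "R s z t = 2 * (\<Sum>j\<in>I. s j * g t (z j))" for s z t
  have upd: "(\<Sum>j\<in>I. g t ((z(i := y)) j) - expectation (g t)) = D z t" for z y t
    unfolding D_def using insert by (intro sum.cong) auto
  have upd2: "(\<Sum>j\<in>I. (s(i := c)) j * g t ((z(i := y)) j)) = (\<Sum>j\<in>I. s j * g t (z j))" for s c z y t
    using insert by (intro sum.cong) auto
  have IH: "(\<integral>\<^sup>+ z. \<Phi> (\<lambda>t. u t + D z t) \<partial>PiM I (\<lambda>_. M))
      \<le> (\<Sum>s\<in>PiE I (\<lambda>_. {- 1, 1}). \<integral>\<^sup>+ z. \<Phi> (\<lambda>t. u t + R s z t) \<partial>PiM I (\<lambda>_. M)) / 2 ^ card I" for u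
    using insert.IH[of u] by (simp add: \<Phi>_def D_def R_def)
  have I: "sigma_finite_measure (PiM I (\<lambda>_. M))"
    by (intro prob_space_imp_sigma_finite prob_space_PiM prob_space_axioms)
  have m1: "(\<lambda>(z, y). \<Phi> (\<lambda>t. x t + D z t + c * g t y)) \<in> borel_measurable (PiM I (\<lambda>_. M) \<Otimes>\<^sub>M M)" for c
    unfolding \<Phi>_def D_def case_prod_unfold by (intro borel_measurable_SUP_ennreal_abs T, measurable)
  \<comment> \<open>Used with \<open>c = 2\<close> and \<open>c = - 2\<close>, that is, with the new
    sign \<open>c / 2\<close>. Fubini moves the new coordinate \<open>y\<close> outside, where
    \<open>c * g t y\<close> is part of the offset in the induction hypothesis.\<close>
  have half: "(\<integral>\<^sup>+ z. \<integral>\<^sup>+ y. \<Phi> (\<lambda>t. x t + D z t + c * g t y) \<partial>M \<partial>PiM I (\<lambda>_. M))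
      \<le> (\<Sum>s\<in>PiE I (\<lambda>_. {- 1, 1}). \<integral>\<^sup>+ z.
          \<Phi> (\<lambda>t. x t + 2 * (\<Sum>j\<in>insert i I. (s(i := c / 2)) j * g t (z j))) \<partial>PiM (insert i I) (\<lambda>_. M)) / 2 ^ card I" for c
  proof -
    have m2: "(\<lambda>(y, z). \<Phi> (\<lambda>t. x t + c * g t y + R s z t)) \<in> borel_measurable (M \<Otimes>\<^sub>M PiM I (\<lambda>_. M))" for s
      unfolding \<Phi>_def R_def case_prod_unfold by (intro borel_measurable_SUP_ennreal_abs T, measurable)
    have m3: "(\<lambda>z. \<Phi> (\<lambda>t. x t + 2 * (\<Sum>j\<in>insert i I. s j * g t (z j)))) \<in> borel_measurable (PiM (insert i I) (\<lambda>_. M))" for s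
      unfolding \<Phi>_def by (intro borel_measurable_SUP_ennreal_abs T, measurable)
    have "(\<integral>\<^sup>+ z. \<integral>\<^sup>+ y. \<Phi> (\<lambda>t. x t + D z t + c * g t y) \<partial>M \<partial>PiM I (\<lambda>_. M))
        = (\<integral>\<^sup>+ y. \<integral>\<^sup>+ z. \<Phi> (\<lambda>t. x t + D z t + c * g t y) \<partial>PiM I (\<lambda>_. M) \<partial>M)"
      by (rule pair_sigma_finite.Fubini'[symmetric])
        (intro pair_sigma_finite.intro sigma_finite_measure_axioms I m1)+
    also have "\<dots> \<le> (\<integral>\<^sup>+ y. (\<Sum>s\<in>PiE I (\<lambda>_. {- 1, 1}). \<integral>\<^sup>+ z. \<Phi> (\<lambda>t. x t + c * g t y + R s z t) \<partial>PiM I (\<lambda>_. M)) / 2 ^ card I \<partial>M)"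
    proof (rule nn_integral_mono)
      fix y
      show "(\<integral>\<^sup>+ z. \<Phi> (\<lambda>t. x t + D z t + c * g t y) \<partial>PiM I (\<lambda>_. M))
        \<le> (\<Sum>s\<in>PiE I (\<lambda>_. {- 1, 1}). \<integral>\<^sup>+ z. \<Phi> (\<lambda>t. x t + c * g t y + R s z t) \<partial>PiM I (\<lambda>_. M)) / 2 ^ card I"
        using IH[of "\<lambda>t. x t + c * g t y"] by (simp only: add_ac)
    qed
    also have "\<dots> = (\<Sum>s\<in>PiE I (\<lambda>_. {- 1, 1}). \<integral>\<^sup>+ y. \<integral>\<^sup>+ z. \<Phi> (\<lambda>t. x t + c * g t y + R s z t) \<partial>PiM I (\<lambda>_. M) \<partial>M) / 2 ^ card I"
      using sigma_finite_measure.borel_measurable_nn_integral[OF I m2] by (simp add: nn_integral_divide nn_integral_sum)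
    also have "\<dots> = (\<Sum>s\<in>PiE I (\<lambda>_. {- 1, 1}). \<integral>\<^sup>+ z.
          \<Phi> (\<lambda>t. x t + 2 * (\<Sum>j\<in>insert i I. (s(i := c / 2)) j * g t (z j))) \<partial>PiM (insert i I) (\<lambda>_. M)) / 2 ^ card I"
    proof (intro arg_cong2[where f = "(/)"] sum.cong refl)
      fix s
      show "(\<integral>\<^sup>+ y. \<integral>\<^sup>+ z. \<Phi> (\<lambda>t. x t + c * g t y + R s z t) \<partial>PiM I (\<lambda>_. M) \<partial>M)
        = (\<integral>\<^sup>+ z. \<Phi> (\<lambda>t. x t + 2 * (\<Sum>j\<in>insert i I. (s(i := c / 2)) j * g t (z j))) \<partial>PiM (insert i I) (\<lambda>_. M))"
        by (subst P.product_nn_integral_insert_rev[OF insert(1,2) m3])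
          (simp only: sum.insert[OF insert(1,2)] upd2 R_def fun_upd_same distrib_left, simp add: add.assoc)
    qed
    finally show ?thesis .
  qed
  let ?A = "\<lambda>s. \<integral>\<^sup>+ z. \<Phi> (\<lambda>t. x t + 2 * (\<Sum>j\<in>insert i I. s j * g t (z j))) \<partial>PiM (insert i I) (\<lambda>_. M)"
  have "(\<integral>\<^sup>+ z. \<Phi> (\<lambda>t. x t + (\<Sum>j\<in>insert i I. g t (z j) - expectation (g t))) \<partial>PiM (insert i I) (\<lambda>_. M))
      = (\<integral>\<^sup>+ z. \<integral>\<^sup>+ y. \<Phi> (\<lambda>t. (x t + D z t) + (g t y - expectation (g t))) \<partial>M \<partial>PiM I (\<lambda>_. M))"
    by (subst P.product_nn_integral_insert[OF insert(1,2)])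
      (unfold \<Phi>_def, intro borel_measurable_SUP_ennreal_abs T, measurable,
       simp only: sum.insert[OF insert(1,2)] upd fun_upd_same add_ac)
  also have "\<dots> \<le> (\<integral>\<^sup>+ z. ((\<integral>\<^sup>+ y. \<Phi> (\<lambda>t. x t + D z t + 2 * g t y) \<partial>M)
      + (\<integral>\<^sup>+ y. \<Phi> (\<lambda>t. x t + D z t + (- 2) * g t y) \<partial>M)) / 2 \<partial>PiM I (\<lambda>_. M))"
  proof (rule nn_integral_mono)
    fix z
    show "(\<integral>\<^sup>+ y. \<Phi> (\<lambda>t. (x t + D z t) + (g t y - expectation (g t))) \<partial>M)
        \<le> ((\<integral>\<^sup>+ y. \<Phi> (\<lambda>t. x t + D z t + 2 * g t y) \<partial>M) + (\<integral>\<^sup>+ y. \<Phi> (\<lambda>t. x t + D z t + (- 2) * g t y) \<partial>M)) / 2"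
      using symmetrization_step[OF T g, where x = "\<lambda>t. x t + D z t"] by (simp add: \<Phi>_def)
  qed
  also have "\<dots> = ((\<integral>\<^sup>+ z. \<integral>\<^sup>+ y. \<Phi> (\<lambda>t. x t + D z t + 2 * g t y) \<partial>M \<partial>PiM I (\<lambda>_. M))
      + (\<integral>\<^sup>+ z. \<integral>\<^sup>+ y. \<Phi> (\<lambda>t. x t + D z t + (- 2) * g t y) \<partial>M \<partial>PiM I (\<lambda>_. M))) / 2"
    using borel_measurable_nn_integral[OF m1[of 2]] borel_measurable_nn_integral[OF m1[of "- 2"]]
    by (simp add: nn_integral_divide nn_integral_add)
  also have "\<dots> \<le> ((\<Sum>s\<in>PiE I (\<lambda>_. {- 1, 1}). ?A (s(i := 2 / 2))) / 2 ^ card I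
      + (\<Sum>s\<in>PiE I (\<lambda>_. {- 1, 1}). ?A (s(i := (- 2) / 2))) / 2 ^ card I) / 2"
    by (intro divide_right_mono_ennreal add_mono half)
  also have "\<dots> = (\<Sum>s\<in>PiE (insert i I) (\<lambda>_. {- 1, 1}). ?A s) / 2 ^ card (insert i I)"
  proof -
    have "(a / 2 ^ n + b / 2 ^ n) / 2 = (a + b) / 2 ^ Suc n" for a b :: ennreal and n
      by (simp add: distrib_left distrib_right divide_ennreal_def ennreal_inverse_mult
          power_less_top_ennreal mult_ac)
    moreover have "card (insert i I) = Suc (card I)"
      using insert(1,2) by simp
    moreover have "2 / 2 = (1 :: real)" "- 2 / 2 = (- 1 :: real)"
      by simp_all
    ultimately show ?thesis
      by (simp only: sum_PiE_insert_signs[OF insert(1,2)] sum.distrib)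
  qed
  finally show ?case
    by (simp add: \<Phi>_def)
qed

section \<open>Uniform entropy\<close>

lemma covering_number_antimono:
  assumes "\<eta> \<le> \<eta>'"
  shows "covering_number \<eta>' F Q \<le> covering_number \<eta> F Q"
  unfolding covering_number_def
  by (rule INF_superset_mono) (use order_trans[OF _ assms] in \<open>blast | simp\<close>)+

text \<open>\<open>enat\<close> is well-ordered, so the infimum over a nonempty family of covers is
  a minimum.\<close>

lemma covering_number_attained:
  assumes "covering_number \<eta> F Q \<noteq> \<infinity>"
  obtains S where "finite S" "S \<subseteq> F" "\<And>h. h \<in> F \<Longrightarrow> \<exists>c\<in>S. L2_norm Q (\<lambda>x. h x - c x) \<le> \<eta>"
    "covering_number \<eta> F Q = enat (card S)"
proof -
  let ?A = "{S. finite S \<and> S \<subseteq> F \<and> (\<forall>h\<in>F. \<exists>c\<in>S. L2_norm Q (\<lambda>x. h x - c x) \<le> \<eta>)}"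
  have "?A \<noteq> {}"
  proof
    assume "?A = {}"
    then show False
      using assms unfolding covering_number_def by (simp only:) (simp add: top_enat_def)
  qed
  then have "(INF S\<in>?A. enat (card S)) \<in> (\<lambda>S. enat (card S)) ` ?A"
    by (metis (no_types, lifting) image_is_empty all_not_in_conv wellorder_InfI)
  then show thesis
    using that unfolding covering_number_def by auto
qed

lemma sqrt_ln_twice_mono: "a \<le> b \<Longrightarrow> sqrt_ln_twice a \<le> sqrt_ln_twice b"
proof (cases a; cases b)
  fix m n assume "a = enat m" "b = enat n" "a \<le> b"
  then show "sqrt_ln_twice a \<le> sqrt_ln_twice b"
    \<comment> \<open>An empty cover gives \<open>ln 0\<close>, whose default value 0 keeps the
      function monotone; the positive case is monotonicity of \<open>ln\<close>.\<close>
    by (cases "m = 0") (auto simp: sqrt_ln_twice_def intro!: ennreal_leI)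
qed (auto simp: sqrt_ln_twice_def)

text \<open>The integrand of \<open>entropy_integral\<close>, named because the dyadic comparison
  rests on its antitonicity.\<close>

definition uniform_entropy :: "('a::topological_space \<Rightarrow> real) set \<Rightarrow> ('a \<Rightarrow> real) \<Rightarrow> real \<Rightarrow> ennreal" where
  "uniform_entropy F C \<epsilon> =
    (SUP Q \<in> M_fin. sqrt_ln_twice (covering_number (ennreal \<epsilon> * L2_norm Q C) F Q))"

lemma uniform_entropy_antimono: "x \<le> y \<Longrightarrow> uniform_entropy F C y \<le> uniform_entropy F C x"
  unfolding uniform_entropy_def
  by (intro SUP_mono' sqrt_ln_twice_mono covering_number_antimono mult_right_mono ennreal_leI) auto

text \<open>Image of the uniform law on the indices, so that coinciding sample points keep their
  multiplicity.\<close>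

definition empirical :: "'i set \<Rightarrow> ('i \<Rightarrow> 'a::topological_space) \<Rightarrow> 'a measure" where
  "empirical I z = distr (measure_pmf (pmf_of_set I)) borel z"

lemma empirical_in_M_fin:
  fixes z :: "'i \<Rightarrow> 'a::t1_space"
  assumes "finite I" "I \<noteq> {}"
  shows "empirical I z \<in> M_fin"
proof -
  have "prob_space (empirical I z)"
    unfolding empirical_def by (intro measure_pmf.prob_space_distr) simp
  moreover have "AE x in empirical I z. x \<in> z ` I"
    unfolding empirical_def using assms
    by (subst AE_distr_iff) (auto simp: AE_measure_pmf_iff intro!: borel_closed finite_imp_closed)
  moreover have "sets (empirical I z) = sets borel"
    by (simp add: empirical_def)
  ultimately show ?thesis
    unfolding M_fin_def using finite_imageI[OF assms(1)] by blast
qed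

lemma L2_norm_empirical:
  assumes I: "finite I" "I \<noteq> {}" and f: "f \<in> borel_measurable borel"
  shows "L2_norm (empirical I z) f = ennreal (sqrt ((\<Sum>j\<in>I. (f (z j))\<^sup>2) / card I))"
proof -
  have "(\<integral>\<^sup>+ x. ennreal ((f x)\<^sup>2) \<partial>empirical I z) = (\<Sum>j\<in>I. ennreal ((f (z j))\<^sup>2)) / card I"
    unfolding empirical_def using I f
    by (subst nn_integral_distr) (auto simp: nn_integral_pmf_of_set)
  also have "\<dots> = ennreal ((\<Sum>j\<in>I. (f (z j))\<^sup>2) / card I)"
    using I by (simp add: card_gt_0_iff divide_ennreal sum_nonneg ennreal_of_nat_eq_real_of_nat)
  finally show ?thesis
    by (simp add: L2_norm_def sum_nonneg)
qed

text \<open>The empirical measure is one competitor in the supremum defining the entropy integrand,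
  so its covering numbers are controlled at every dyadic scale. The nets depend on \<open>z\<close>,
  the bound on their cardinalities does not. The weight 1 / \<open>card I\<close> occurs in both
  norms and cancels, which leaves plain sums of squares.\<close>

lemma empirical_nets:
  fixes F :: "('a::t1_space \<Rightarrow> real) set" and z :: "'i \<Rightarrow> 'a"
  assumes I: "finite I" "I \<noteq> {}" and F: "F \<noteq> {}" "\<And>f. f \<in> F \<Longrightarrow> f \<in> borel_measurable borel"
    and C: "C \<in> borel_measurable borel"
    and J: "entropy_integral F C (1 / 2) < \<infinity>"
  obtains S where "\<And>k :: nat. finite (S k)" "\<And>k. S k \<noteq> {}" "\<And>k. S k \<subseteq> F"
    "\<And>k f. f \<in> F \<Longrightarrow> \<exists>g\<in>S k. (\<Sum>j\<in>I. (f (z j) - g (z j))\<^sup>2) \<le> (sqrt (\<Sum>j\<in>I. (C (z j))\<^sup>2) / 2 ^ Suc k)\<^sup>2"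
    "\<And>K. (\<Sum>k\<le>K. sqrt (ln (2 * card (S k))) / 2 ^ k) \<le> 4 * enn2real (entropy_integral F C (1 / 2))"
proof -
  define Q where "Q = empirical I z"
  define r where "r = sqrt (\<Sum>j\<in>I. (C (z j))\<^sup>2)"
  define J where "J = entropy_integral F C (1 / 2)"
  define h where "h = uniform_entropy F C"
  define N where "N k = covering_number (ennreal (1 / 2 ^ Suc k) * L2_norm Q C) F Q" for k
  have dyadic: "(\<Sum>k\<le>K. h (1 / 2 ^ Suc k) * ennreal (1 / 2 ^ k)) \<le> 4 * J" for K
    using dyadic_sum_le_nn_integral[of h K] uniform_entropy_antimono[of _ _ F C]
    by (simp add: h_def J_def entropy_integral_def uniform_entropy_def)
  have J4: "4 * J < \<infinity>"
    using J by (simp add: J_def ennreal_mult_less_top)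
  have N_le: "sqrt_ln_twice (N k) \<le> h (1 / 2 ^ Suc k)" for k
    unfolding h_def uniform_entropy_def N_def Q_def
    by (rule SUP_upper) (rule empirical_in_M_fin[OF I])
  \<comment> \<open>An infinite covering number at a single scale would make one summand of the
    dyadic sum infinite.\<close>
  have "N k \<noteq> \<infinity>" for k
  proof
    assume "N k = \<infinity>"
    then have "h (1 / 2 ^ Suc k) = \<infinity>"
      using N_le[of k] by (simp add: sqrt_ln_twice_def top_unique)
    then have "\<infinity> = h (1 / 2 ^ Suc k) * ennreal (1 / 2 ^ k)"
      by (simp add: ennreal_top_mult)
    also have "\<dots> \<le> (\<Sum>k\<le>k. h (1 / 2 ^ Suc k) * ennreal (1 / 2 ^ k))"
      by (intro member_le_sum) auto
    also have "\<dots> < \<infinity>"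
      using dyadic[of k] J4 by (rule le_less_trans)
    finally show False by simp
  qed
  then have "\<forall>k. \<exists>S. finite S \<and> S \<subseteq> F \<and> (\<forall>h\<in>F. \<exists>c\<in>S. L2_norm Q (\<lambda>x. h x - c x) \<le> ennreal (1 / 2 ^ Suc k) * L2_norm Q C)
      \<and> N k = enat (card S)"
    unfolding N_def by (intro allI) (rule covering_number_attained, assumption, blast)
  then obtain S where S: "\<And>k. finite (S k)" "\<And>k. S k \<subseteq> F" "\<And>k. N k = enat (card (S k))"
    and net: "\<And>k h. h \<in> F \<Longrightarrow> \<exists>c\<in>S k. L2_norm Q (\<lambda>x. h x - c x) \<le> ennreal (1 / 2 ^ Suc k) * L2_norm Q C"
    by metis
  show thesis
  proof (rule that[of S])
    show "finite (S k)" "S k \<subseteq> F" for k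
      by (fact S)+
    show "S k \<noteq> {}" for k
      using net F(1) by blast
    show "\<exists>g\<in>S k. (\<Sum>j\<in>I. (f (z j) - g (z j))\<^sup>2) \<le> (sqrt (\<Sum>j\<in>I. (C (z j))\<^sup>2) / 2 ^ Suc k)\<^sup>2"
      if f: "f \<in> F" for k f
    proof -
      obtain g where g: "g \<in> S k" "L2_norm Q (\<lambda>x. f x - g x) \<le> ennreal (1 / 2 ^ Suc k) * L2_norm Q C"
        using net[OF f] by blast
      have gF: "g \<in> F"
        using g S by auto
      have "ennreal (sqrt ((\<Sum>j\<in>I. (f (z j) - g (z j))\<^sup>2) / card I))
          \<le> ennreal (1 / 2 ^ Suc k * sqrt ((\<Sum>j\<in>I. (C (z j))\<^sup>2) / card I))"
        using g(2) F(2)[OF f] F(2)[OF gF] C I unfolding Q_def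
        by (subst ennreal_mult') (simp_all add: L2_norm_empirical)
      then have "sqrt ((\<Sum>j\<in>I. (f (z j) - g (z j))\<^sup>2) / card I)
          \<le> 1 / 2 ^ Suc k * sqrt ((\<Sum>j\<in>I. (C (z j))\<^sup>2) / card I)"
        by (subst (asm) ennreal_le_iff) (auto intro!: sum_nonneg divide_nonneg_nonneg)
      then have "sqrt (\<Sum>j\<in>I. (f (z j) - g (z j))\<^sup>2) \<le> r / 2 ^ Suc k"
        using I by (simp add: real_sqrt_divide r_def card_gt_0_iff divide_le_cancel divide_simps)
      then have "(sqrt (\<Sum>j\<in>I. (f (z j) - g (z j))\<^sup>2))\<^sup>2 \<le> (r / 2 ^ Suc k)\<^sup>2"
        by (intro power_mono) (auto intro: sum_nonneg)
      then show ?thesis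
        using g(1) by (auto simp: r_def sum_nonneg)
    qed
    show "(\<Sum>k\<le>K. sqrt (ln (2 * card (S k))) / 2 ^ k) \<le> 4 * enn2real (entropy_integral F C (1 / 2))" for K
    proof -
      have nn: "0 \<le> sqrt (ln (2 * card (S k)))" for k
        by (cases "card (S k) = 0") auto
      have "ennreal (\<Sum>k\<le>K. sqrt (ln (2 * card (S k))) / 2 ^ k) = (\<Sum>k\<le>K. ennreal (sqrt (ln (2 * card (S k))) * (1 / 2 ^ k)))"
        using nn by (subst sum_ennreal) auto
      also have "\<dots> = (\<Sum>k\<le>K. sqrt_ln_twice (N k) * ennreal (1 / 2 ^ k))"
        using nn by (intro sum.cong refl) (simp add: S(3) sqrt_ln_twice_def flip: ennreal_mult'')
      also have "\<dots> \<le> (\<Sum>k\<le>K. h (1 / 2 ^ Suc k) * ennreal (1 / 2 ^ k))"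
        by (intro sum_mono mult_right_mono N_le) auto
      also have "\<dots> \<le> 4 * J"
        by (rule dyadic)
      also have "\<dots> = ennreal (4 * enn2real J)"
        using J by (simp add: J_def ennreal_mult' less_top)
      finally show ?thesis
        by (subst (asm) ennreal_le_iff) (simp_all add: J_def)
    qed
  qed
qed

lemma expected_supremum_bound:
  fixes G :: "'t \<Rightarrow> 'a::t1_space \<Rightarrow> real" and I :: "'i set"
  assumes P: "prob_space P" "sets P = sets borel" and I: "finite I" "I \<noteq> {}"
    and T: "countable T" "T \<subseteq> \<Theta>" "\<Theta> \<noteq> {}"
    and G: "\<And>t. t \<in> \<Theta> \<Longrightarrow> G t \<in> borel_measurable borel" "\<And>t z. t \<in> \<Theta> \<Longrightarrow> \<bar>G t z\<bar> \<le> \<xi> z"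
    and \<xi>: "\<xi> \<in> borel_measurable borel" "integrable P \<xi>" "integrable P (\<lambda>z. (\<xi> z)\<^sup>2)"
    and J: "entropy_integral (G ` \<Theta>) \<xi> (1 / 2) < \<infinity>"
  shows "(\<integral>\<^sup>+ z. (SUP t\<in>T. ennreal \<bar>\<Sum>j\<in>I. G t (z j) - (\<integral>y. G t y \<partial>P)\<bar>) \<partial>PiM I (\<lambda>_. P))
    \<le> ennreal (sqrt (card I) * (sqrt 2 * (4 * enn2real (entropy_integral (G ` \<Theta>) \<xi> (1 / 2))) + 1)
        * (1 + (\<integral>y. (\<xi> y)\<^sup>2 \<partial>P)))"
proof -
  interpret P: prob_space P by fact
  \<comment> \<open>The constant of \<open>rademacher_entropy_bound\<close>: \<open>sqrt 2\<close>
    stems from the maximal inequality, 4 from the dyadic comparison, and 1 from the remainder after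
    the last net.\<close>
  define B where "B = sqrt 2 * (4 * enn2real (entropy_integral (G ` \<Theta>) \<xi> (1 / 2))) + 1"
  define n where "n = card I"
  have n: "n > 0"
    using I by (simp add: n_def card_gt_0_iff)
  have B: "B \<ge> 0"
    by (simp add: B_def)
  have Gm: "G t \<in> borel_measurable P" if "t \<in> T" for t
    using G(1)[of t] that T(2) measurable_cong_sets[OF P(2) refl, of borel] by auto
  have \<xi>m [measurable]: "\<xi> \<in> borel_measurable P"
    using \<xi>(2) by auto
  have Gi: "integrable P (G t)" if t: "t \<in> T" for t
    using \<xi>(2) Gm[OF t] by (rule Bochner_Integration.integrable_bound)
      (use G(2)[of t] t T(2) in \<open>auto intro!: AE_I2 intro: order_trans[OF _ abs_ge_self]\<close>)
  let ?\<Sigma> = "PiE I (\<lambda>_. {- 1, 1 :: real})"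
  define r where "r z = sqrt (\<Sum>j\<in>I. (\<xi> (z j))\<^sup>2)" for z :: "'i \<Rightarrow> 'a"
  have entropy: "(\<Sum>s\<in>?\<Sigma>. SUP t\<in>T. ennreal \<bar>\<Sum>j\<in>I. s j * G t (z j)\<bar>) \<le> ennreal (2 ^ n * (r z * B))" for z
  proof -
    have Fm: "f \<in> borel_measurable borel" if "f \<in> G ` \<Theta>" for f
      using that G(1) by auto
    obtain S where S: "\<And>k :: nat. finite (S k)" "\<And>k. S k \<noteq> {}" "\<And>k. S k \<subseteq> G ` \<Theta>"
      "\<And>k f. f \<in> G ` \<Theta> \<Longrightarrow> \<exists>g\<in>S k. (\<Sum>j\<in>I. (f (z j) - g (z j))\<^sup>2) \<le> (sqrt (\<Sum>j\<in>I. (\<xi> (z j))\<^sup>2) / 2 ^ Suc k)\<^sup>2"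
      "\<And>K. (\<Sum>k\<le>K. sqrt (ln (2 * card (S k))) / 2 ^ k) \<le> 4 * enn2real (entropy_integral (G ` \<Theta>) \<xi> (1 / 2))"
      using empirical_nets[OF I _ Fm \<xi>(1) J, of z] T(3) by blast
    have bound: "(\<Sum>j\<in>I. (f (z j))\<^sup>2) \<le> (r z)\<^sup>2" if "f \<in> G ` \<Theta>" for f
    proof -
      have "(f (z j))\<^sup>2 \<le> (\<xi> (z j))\<^sup>2" for j
        using that G(2) by (intro abs_le_square_iff[THEN iffD1]) (force intro: order_trans[OF _ abs_ge_self])
      then show ?thesis
        by (auto simp: r_def sum_nonneg intro: sum_mono)
    qed
    have "(\<Sum>s\<in>?\<Sigma>. SUP t\<in>T. ennreal \<bar>\<Sum>j\<in>I. s j * G t (z j)\<bar>)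
        \<le> (\<Sum>s\<in>?\<Sigma>. SUP f\<in>G ` \<Theta>. ennreal \<bar>\<Sum>j\<in>I. s j * f (z j)\<bar>)"
      unfolding image_image by (intro sum_mono SUP_subset_mono T order_refl)
    also have "\<dots> \<le> ennreal (2 ^ n * (r z * B))"
      unfolding B_def n_def
      by (rule rademacher_entropy_bound[OF I(1) S(1-3) _ bound])
        (use S(4,5) in \<open>auto simp: r_def sum_nonneg\<close>)
    finally show ?thesis .
  qed
  \<comment> \<open>The inequality a <= (1 + a^2) / 2 replaces Jensen's inequality for the square
    root and leaves an expression linear in the squares of \<open>\<xi>\<close>. Its factor 1 / 2
    cancels the 2 from symmetrization.\<close>
  have r_le: "r z \<le> sqrt n * ((1 + (\<Sum>j\<in>I. (\<xi> (z j))\<^sup>2) / n) / 2)" for z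
  proof -
    define a where "a = sqrt ((\<Sum>j\<in>I. (\<xi> (z j))\<^sup>2) / n)"
    have a2: "a\<^sup>2 = (\<Sum>j\<in>I. (\<xi> (z j))\<^sup>2) / n"
      by (simp add: a_def sum_nonneg)
    have "r z = sqrt n * a"
      using n by (simp add: r_def a_def real_sqrt_divide)
    also have "a \<le> (1 + a\<^sup>2) / 2"
      using zero_le_power2[of "a - 1"] by (simp add: power2_eq_square algebra_simps)
    finally show ?thesis
      by (simp add: a2 mult_left_mono)
  qed
  have comp: "(\<integral>\<^sup>+ z. ennreal ((\<xi> (z j))\<^sup>2) \<partial>PiM I (\<lambda>_. P)) = ennreal (\<integral>y. (\<xi> y)\<^sup>2 \<partial>P)" if "j \<in> I" for j
  proof -
    have "(\<integral>\<^sup>+ z. ennreal ((\<xi> (z j))\<^sup>2) \<partial>PiM I (\<lambda>_. P))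
        = (\<integral>\<^sup>+ y. ennreal ((\<xi> y)\<^sup>2) \<partial>distr (PiM I (\<lambda>_. P)) P (\<lambda>z. z j))"
      using that by (subst nn_integral_distr) auto
    also have "distr (PiM I (\<lambda>_. P)) P (\<lambda>z. z j) = P"
      using that P by (intro distr_PiM_component)
    finally show ?thesis
      using \<xi>(3) by (simp add: nn_integral_eq_integral)
  qed
  have EQ: "0 \<le> (\<integral>y. (\<xi> y)\<^sup>2 \<partial>P)"
    by simp
  interpret PI: prob_space "PiM I (\<lambda>_. P)"
    by (intro prob_space_PiM P)
  have meas: "(\<lambda>z. SUP t\<in>T. ennreal \<bar>\<Sum>j\<in>I. s j * G t (z j)\<bar>) \<in> borel_measurable (PiM I (\<lambda>_. P))" for s
    using Gm by (intro borel_measurable_SUP_ennreal_abs T) auto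
  have "(\<integral>\<^sup>+ z. (SUP t\<in>T. ennreal \<bar>\<Sum>j\<in>I. G t (z j) - (\<integral>y. G t y \<partial>P)\<bar>) \<partial>PiM I (\<lambda>_. P))
      \<le> (\<Sum>s\<in>?\<Sigma>. \<integral>\<^sup>+ z. (SUP t\<in>T. ennreal \<bar>2 * (\<Sum>j\<in>I. s j * G t (z j))\<bar>) \<partial>PiM I (\<lambda>_. P)) / 2 ^ n"
    using P.symmetrization[OF T(1) Gi I(1), where x = "\<lambda>_. 0"] by (simp add: n_def)
  also have "\<dots> = (\<Sum>s\<in>?\<Sigma>. \<integral>\<^sup>+ z. 2 * (SUP t\<in>T. ennreal \<bar>\<Sum>j\<in>I. s j * G t (z j)\<bar>) \<partial>PiM I (\<lambda>_. P)) / 2 ^ n"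
    by (simp add: abs_mult ennreal_mult' SUP_mult_left_ennreal)
  also have "\<dots> = (\<integral>\<^sup>+ z. 2 * (\<Sum>s\<in>?\<Sigma>. SUP t\<in>T. ennreal \<bar>\<Sum>j\<in>I. s j * G t (z j)\<bar>) \<partial>PiM I (\<lambda>_. P)) / 2 ^ n"
    using meas by (simp add: nn_integral_sum nn_integral_cmult sum_distrib_left)
  also have "\<dots> \<le> (\<integral>\<^sup>+ z. ennreal (2 ^ n * (sqrt n * B)) * ennreal (1 + (\<Sum>j\<in>I. (\<xi> (z j))\<^sup>2) / n) \<partial>PiM I (\<lambda>_. P)) / 2 ^ n"
  proof (intro divide_right_mono_ennreal nn_integral_mono)
    fix z
    have "2 * (\<Sum>s\<in>?\<Sigma>. SUP t\<in>T. ennreal \<bar>\<Sum>j\<in>I. s j * G t (z j)\<bar>) \<le> 2 * ennreal (2 ^ n * (r z * B))"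
      by (intro mult_left_mono entropy) auto
    also have "\<dots> = ennreal (2 * 2 ^ n * B * r z)"
      using B by (simp add: r_def ennreal_mult' mult_ac)
    also have "\<dots> \<le> ennreal (2 * 2 ^ n * B * (sqrt n * ((1 + (\<Sum>j\<in>I. (\<xi> (z j))\<^sup>2) / n) / 2)))"
      using B by (intro ennreal_leI mult_left_mono r_le) auto
    also have "\<dots> = ennreal (2 ^ n * (sqrt n * B)) * ennreal (1 + (\<Sum>j\<in>I. (\<xi> (z j))\<^sup>2) / n)"
      using B by (simp add: ennreal_mult'[symmetric] mult_ac)
    finally show "2 * (\<Sum>s\<in>?\<Sigma>. SUP t\<in>T. ennreal \<bar>\<Sum>j\<in>I. s j * G t (z j)\<bar>)
        \<le> ennreal (2 ^ n * (sqrt n * B)) * ennreal (1 + (\<Sum>j\<in>I. (\<xi> (z j))\<^sup>2) / n)" .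
  qed
  also have "(\<integral>\<^sup>+ z. ennreal (2 ^ n * (sqrt n * B)) * ennreal (1 + (\<Sum>j\<in>I. (\<xi> (z j))\<^sup>2) / n) \<partial>PiM I (\<lambda>_. P))
      = ennreal (2 ^ n * (sqrt n * B)) * ennreal (1 + (\<integral>y. (\<xi> y)\<^sup>2 \<partial>P))"
  proof -
    have "(\<integral>\<^sup>+ z. ennreal (1 + (\<Sum>j\<in>I. (\<xi> (z j))\<^sup>2) / n) \<partial>PiM I (\<lambda>_. P))
        = (\<integral>\<^sup>+ z. 1 + ennreal (1 / n) * (\<Sum>j\<in>I. ennreal ((\<xi> (z j))\<^sup>2)) \<partial>PiM I (\<lambda>_. P))"
      by (intro nn_integral_cong) (simp add: sum_nonneg ennreal_mult'[symmetric] flip: ennreal_plus ennreal_1)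
    also have "\<dots> = 1 + ennreal (1 / n) * (\<Sum>j\<in>I. ennreal (\<integral>y. (\<xi> y)\<^sup>2 \<partial>P))"
      by (subst nn_integral_add) (auto simp: nn_integral_cmult nn_integral_sum comp PI.emeasure_space_1 simp del: sum_ennreal)
    also have "(\<Sum>j\<in>I. ennreal (\<integral>y. (\<xi> y)\<^sup>2 \<partial>P)) = ennreal (n * (\<integral>y. (\<xi> y)\<^sup>2 \<partial>P))"
      by (subst sum_ennreal) (auto simp: n_def)
    also have "1 + ennreal (1 / n) * \<dots> = ennreal (1 + (\<integral>y. (\<xi> y)\<^sup>2 \<partial>P))"
      using n by (simp add: ennreal_mult'[symmetric] flip: ennreal_plus ennreal_1)
    finally show ?thesis
      by (simp add: nn_integral_cmult)
  qed
  also have "ennreal (2 ^ n * (sqrt n * B)) * ennreal (1 + (\<integral>y. (\<xi> y)\<^sup>2 \<partial>P)) / 2 ^ n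
      = ennreal (sqrt n * B * (1 + (\<integral>y. (\<xi> y)\<^sup>2 \<partial>P)))"
  proof -
    have "(2 ^ n :: ennreal) = ennreal (2 ^ n)"
      by (simp add: ennreal_power[symmetric])
    then show ?thesis
      using B EQ by (simp add: ennreal_mult'[symmetric] divide_ennreal del: ennreal_plus)
  qed
  finally show ?thesis
    by (simp add: B_def n_def)
qed

section \<open>Tightness\<close>

text \<open>Here completeness enters: the infimum over all of \<open>\<Theta>\<close> is known to
  agree with a measurable function only almost surely.\<close>

lemma (in complete_measure) borel_measurable_AE_eq:
  assumes g: "g \<in> borel_measurable M" and ae: "AE x in M. f x = g x"
  shows "f \<in> borel_measurable M"
proof (rule measurableI)
  fix B :: "'b set" assume B: "B \<in> sets borel"
  show "f -` B \<inter> space M \<in> sets M"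
  proof (rule in_sets_AE)
    show "AE x in M. x \<in> g -` B \<inter> space M \<longleftrightarrow> x \<in> f -` B \<inter> space M"
      using ae by eventually_elim auto
    show "g -` B \<inter> space M \<in> sets M"
      using g B by (rule measurable_sets)
  qed auto
qed simp

text \<open>Density refers to the values of \<open>e\<close> and not to a topology on the
  parameters. This is the form in which \<open>A3\<close> yields it, both for the means and for the
  empirical averages.\<close>

lemma cINF_eq_of_dense:
  fixes e :: "'t \<Rightarrow> real"
  assumes D: "D \<subseteq> \<Theta>" "D \<noteq> {}" and bdd: "bdd_below (e ` \<Theta>)"
    and dense: "\<And>t. t \<in> \<Theta> \<Longrightarrow> (INF t'\<in>D. \<bar>e t - e t'\<bar>) = 0"
  shows "(INF t\<in>\<Theta>. e t) = (INF t\<in>D. e t)"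
proof (rule antisym)
  show "(INF t\<in>\<Theta>. e t) \<le> (INF t\<in>D. e t)"
    using D bdd by (intro cINF_superset_mono) auto
  show "(INF t\<in>D. e t) \<le> (INF t\<in>\<Theta>. e t)"
  proof (intro cINF_greatest)
    fix t assume t: "t \<in> \<Theta>"
    show "(INF t\<in>D. e t) \<le> e t"
    proof (rule field_le_epsilon)
      fix \<epsilon> :: real assume "\<epsilon> > 0"
      then obtain t' where t': "t' \<in> D" "\<bar>e t - e t'\<bar> < \<epsilon>"
        using cInf_lessD[of "(\<lambda>t'. \<bar>e t - e t'\<bar>) ` D" \<epsilon>] dense[OF t] D(2) by auto
      have "(INF t\<in>D. e t) \<le> e t'"
        using t' by (intro cINF_lower bdd_below_mono[OF bdd image_mono[OF D(1)]])
      then show "(INF t\<in>D. e t) \<le> e t + \<epsilon>"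
        using t'(2) by linarith
    qed
  qed (use D in auto)
qed

text \<open>The infimum is 1-Lipschitz in the uniform norm; this passes from the empirical process
  to the optimal values.\<close>

lemma abs_cINF_diff_le:
  fixes e m :: "'t \<Rightarrow> real"
  assumes "D \<noteq> {}" "bdd_below (e ` D)" "bdd_below (m ` D)" and le: "\<And>t. t \<in> D \<Longrightarrow> \<bar>e t - m t\<bar> \<le> c"
  shows "\<bar>(INF t\<in>D. e t) - (INF t\<in>D. m t)\<bar> \<le> c"
proof -
  have half: "(INF t\<in>D. f t) - c \<le> (INF t\<in>D. g t)"
    if "bdd_below (f ` D)" "\<And>t. t \<in> D \<Longrightarrow> \<bar>f t - g t\<bar> \<le> c" for f g :: "'t \<Rightarrow> real"
  proof (rule cINF_greatest)
    fix t assume "t \<in> D"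
    then show "(INF t\<in>D. f t) - c \<le> g t"
      using cINF_lower[OF that(1), of t] that(2)[of t] by linarith
  qed fact
  show ?thesis
    using half[of e m] half[of m e] assms by (auto simp: abs_minus_commute abs_le_iff)
qed

lemma (in prob_space) uniformly_tight_of_bounded_L1:
  fixes X :: "nat \<Rightarrow> 'a \<Rightarrow> real"
  assumes X: "\<And>n. X n \<in> borel_measurable M" and C: "C \<ge> 0"
    and le: "\<And>n. (\<integral>\<^sup>+ \<omega>. ennreal \<bar>X n \<omega>\<bar> \<partial>M) \<le> ennreal C"
  shows "uniformly_tight M X"
  unfolding uniformly_tight_def tight_def
proof (intro conjI allI impI X)
  show "real_distribution (distr M borel (X n))" for n
    by (rule real_distribution_distr[OF X])
next
  fix \<epsilon> :: real assume \<epsilon>: "\<epsilon> > 0"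
  \<comment> \<open>Adding 1 makes \<open>K\<close> positive even for \<open>C = 0\<close> and the
    Markov bound \<open>C / K\<close> strictly smaller than \<open>\<epsilon>\<close>.\<close>
  define K where "K = (C + 1) / \<epsilon>"
  have K: "K > 0"
    using C \<epsilon> by (simp add: K_def)
  have "measure (distr M borel (X n)) {- K<..K} > 1 - \<epsilon>" for n
  proof -
    let ?B = "{\<omega>\<in>space M. 1 \<le> ennreal (1 / K) * ennreal \<bar>X n \<omega>\<bar>}"
    have [measurable]: "X n \<in> borel_measurable M"
      by fact
    have "emeasure M ?B \<le> ennreal (1 / K) * (\<integral>\<^sup>+ \<omega>. ennreal \<bar>X n \<omega>\<bar> * indicator (space M) \<omega> \<partial>M)"
      by (rule nn_integral_Markov_inequality) auto
    also have "(\<integral>\<^sup>+ \<omega>. ennreal \<bar>X n \<omega>\<bar> * indicator (space M) \<omega> \<partial>M) = (\<integral>\<^sup>+ \<omega>. ennreal \<bar>X n \<omega>\<bar> \<partial>M)"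
      by (intro nn_integral_cong) simp
    also have "ennreal (1 / K) * \<dots> \<le> ennreal (1 / K) * ennreal C"
      by (intro mult_left_mono le) simp
    also have "\<dots> = ennreal (C / K)"
      using K C by (simp add: ennreal_mult'[symmetric])
    finally have "prob ?B \<le> C / K"
      using K C by (simp add: emeasure_eq_measure)
    also have "C / K < \<epsilon>"
      using C \<epsilon> by (simp add: K_def field_simps)
    finally have "prob ?B < \<epsilon>" .
    moreover have "prob (space M - ?B) = 1 - prob ?B"
      by (rule prob_compl) measurable
    moreover have "prob (space M - ?B) \<le> prob (X n -` {- K<..K} \<inter> space M)"
    proof (rule finite_measure_mono)
      show "space M - ?B \<subseteq> X n -` {- K<..K} \<inter> space M"
        using K by (auto simp: ennreal_mult'[symmetric] not_le abs_less_iff simp flip: ennreal_1)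
    qed measurable
    ultimately show ?thesis
      by (simp add: measure_distr)
  qed
  moreover have "- K < K"
    using K by simp
  ultimately show "\<exists>a b. a < b \<and> (\<forall>n. 1 - \<epsilon> < measure (distr M borel (X n)) {a<..b})"
    by blast
qed

section \<open>Almost sure reduction to the countable subset and the uniform first moment
  bound\<close>

theorem theorem2p5:
  fixes \<Theta> :: "(real ^ 'm) set"
    and M :: "'w measure"
    and Z :: "nat \<Rightarrow> 'w \<Rightarrow> real ^ 'd"
    and PZ :: "(real ^ 'd) measure"
    and G :: "real ^ 'm \<Rightarrow> real ^ 'd \<Rightarrow> real"
    and \<xi> :: "real ^ 'd \<Rightarrow> real"
  assumes "\<Theta> \<noteq> {}" and "compact \<Theta>"
    and "prob_space M" and "complete_measure M" and "atomless M"
    and indep: "prob_space.indep_vars M (\<lambda>_. borel) Z {1..}"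
    and ident: "\<And>j. j \<ge> 1 \<Longrightarrow> distr M borel (Z j) = PZ"
    and A1: "\<And>\<theta>. \<theta> \<in> \<Theta> \<Longrightarrow> G \<theta> \<in> borel_measurable borel"
    and A2: "\<And>z. 0 < \<xi> z" "\<xi> \<in> borel_measurable borel" "integrable PZ \<xi>"
      "\<And>\<theta> z. \<theta> \<in> \<Theta> \<Longrightarrow> \<bar>G \<theta> z\<bar> \<le> \<xi> z"
    and A3: "\<exists>\<Theta>' (N :: nat \<Rightarrow> (nat \<Rightarrow> real ^ 'd) set). countable \<Theta>' \<and> \<Theta>' \<noteq> {} \<and> \<Theta>' \<subseteq> \<Theta> \<and>
      (\<forall>n\<ge>1. N n \<in> null_sets (Pi\<^sub>M {1..n} (\<lambda>_. PZ))) \<and>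
      (\<forall>n\<ge>1. \<forall>\<theta>\<in>\<Theta>. \<forall>z \<in> space (Pi\<^sub>M {1..n} (\<lambda>_. PZ)) - N n.
         (INF \<theta>'\<in>\<Theta>'. \<bar>(\<integral>\<omega>. G \<theta>' (Z 1 \<omega>) \<partial>M) - (\<integral>\<omega>. G \<theta> (Z 1 \<omega>) \<partial>M)\<bar>) = 0 \<and>
         (INF \<theta>'\<in>\<Theta>'. Max ((\<lambda>j. \<bar>G \<theta> (z j) - G \<theta>' (z j)\<bar>) ` {1..n})) = 0)"
    and "integrable PZ (\<lambda>z. (\<xi> z)\<^sup>2)"
    and "entropy_integral (G ` \<Theta>) \<xi> (1 / 2) < \<infinity>"
  shows "uniformly_tight M (\<lambda>k. let n = Suc k in (\<lambda>\<omega>.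
           sqrt (real n) *
             ((INF \<theta>\<in>\<Theta>. 1 / real n * (\<Sum>j=1..n. G \<theta> (Z j \<omega>)))
              - (INF \<theta>\<in>\<Theta>. \<integral>\<omega>'. G \<theta> (Z 1 \<omega>') \<partial>M))))"
proof -
  interpret M: prob_space M by fact
  interpret cM: complete_measure M by fact
  define m where "m t = (\<integral>y. G t y \<partial>PZ)" for t
  define B where "B = (sqrt 2 * (4 * enn2real (entropy_integral (G ` \<Theta>) \<xi> (1 / 2))) + 1) * (1 + (\<integral>y. (\<xi> y)\<^sup>2 \<partial>PZ))"
  have B: "B \<ge> 0"
    by (simp add: B_def)
  have Z [measurable]: "Z j \<in> borel_measurable M" if "j \<ge> 1" for j
    using indep that by (auto simp: M.indep_vars_def)
  have PZ_sets: "sets PZ = sets borel"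
    using ident[of 1] by auto
  have PZ: "prob_space PZ"
    using M.prob_space_distr[OF Z[of 1]] ident[of 1] by simp
  have mean: "(\<integral>\<omega>. G t (Z 1 \<omega>) \<partial>M) = m t" if "t \<in> \<Theta>" for t
    unfolding m_def using ident[of 1] integral_distr[OF Z[of 1] A1[OF that]] by simp
  obtain D and N :: "nat \<Rightarrow> (nat \<Rightarrow> real ^ 'd) set"
    where D: "countable D" "D \<noteq> {}" "D \<subseteq> \<Theta>"
      and N_all: "\<forall>n\<ge>1. N n \<in> null_sets (Pi\<^sub>M {1..n} (\<lambda>_. PZ))"
      and dense_all: "\<forall>n\<ge>1. \<forall>\<theta>\<in>\<Theta>. \<forall>z \<in> space (Pi\<^sub>M {1..n} (\<lambda>_. PZ)) - N n.
         (INF \<theta>'\<in>D. \<bar>(\<integral>\<omega>. G \<theta>' (Z 1 \<omega>) \<partial>M) - (\<integral>\<omega>. G \<theta> (Z 1 \<omega>) \<partial>M)\<bar>) = 0 \<and>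
         (INF \<theta>'\<in>D. Max ((\<lambda>j. \<bar>G \<theta> (z j) - G \<theta>' (z j)\<bar>) ` {1..n})) = 0"
    using A3 by (elim exE conjE) (rule that)
  note N = N_all[rule_format] and dense = dense_all[rule_format]
  \<comment> \<open>A real-valued \<open>INF\<close> is meaningful only for sets bounded below. The
    envelope provides this for the means here and for the empirical averages in
    \<open>e_bdd\<close>.\<close>
  have m_bdd: "bdd_below (m ` \<Theta>)"
  proof (rule bdd_belowI2)
    fix t assume t: "t \<in> \<Theta>"
    have "norm (m t) \<le> (\<integral>y. \<xi> y \<partial>PZ)"
      unfolding m_def using A1[OF t] A2 t measurable_cong_sets[OF PZ_sets refl, of borel]
      by (intro Bochner_Integration.integral_norm_bound_integral)
         (auto intro!: Bochner_Integration.integrable_bound[OF A2(3)] AE_I2 order_trans[OF A2(4)[OF t] abs_ge_self])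
    then show "- (\<integral>y. \<xi> y \<partial>PZ) \<le> m t"
      by (simp add: abs_le_iff)
  qed
  have main: "(\<lambda>\<omega>. sqrt (real n) * ((INF \<theta>\<in>\<Theta>. 1 / real n * (\<Sum>j=1..n. G \<theta> (Z j \<omega>)))
        - (INF \<theta>\<in>\<Theta>. \<integral>\<omega>'. G \<theta> (Z 1 \<omega>') \<partial>M))) \<in> borel_measurable M \<and>
      (\<integral>\<^sup>+ \<omega>. ennreal \<bar>sqrt (real n) * ((INF \<theta>\<in>\<Theta>. 1 / real n * (\<Sum>j=1..n. G \<theta> (Z j \<omega>)))
        - (INF \<theta>\<in>\<Theta>. \<integral>\<omega>'. G \<theta> (Z 1 \<omega>') \<partial>M))\<bar> \<partial>M) \<le> ennreal B" if n: "n \<ge> 1" for n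
  proof -
    let ?I = "{1..n}"
    let ?P = "Pi\<^sub>M ?I (\<lambda>_. PZ)"
    define e where "e \<omega> t = 1 / real n * (\<Sum>j=1..n. G t (Z j \<omega>))" for \<omega> t
    define X where "X \<omega> = sqrt n * ((INF t\<in>\<Theta>. e \<omega> t) - (INF t\<in>\<Theta>. m t))" for \<omega>
    define W where "W \<omega> = (\<lambda>j\<in>?I. Z j \<omega>)" for \<omega>
    define S where "S z = (SUP t\<in>D. ennreal \<bar>\<Sum>j\<in>?I. G t (z j) - m t\<bar>)" for z :: "nat \<Rightarrow> real ^ 'd"
    have W_meas: "W \<in> M \<rightarrow>\<^sub>M ?P"
      unfolding W_def using Z measurable_cong_sets[OF refl PZ_sets, of M]
      by (intro measurable_restrict) auto
    \<comment> \<open>Independence and identical distribution enter here; this identity carries both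
      the null set \<open>N n\<close> and the expectation bound from the product space to
      \<open>M\<close>.\<close>
    have law: "distr M ?P W = ?P"
    proof -
      have "M.indep_vars (\<lambda>_. borel) Z ?I"
        using indep by (rule M.indep_vars_subset) auto
      then have "distr M (Pi\<^sub>M ?I (\<lambda>_. borel)) W = Pi\<^sub>M ?I (\<lambda>j. distr M borel (Z j))"
        unfolding W_def using n Z by (subst (asm) M.indep_vars_iff_distr_eq_PiM') auto
      also have "Pi\<^sub>M ?I (\<lambda>j. distr M borel (Z j)) = ?P"
        using ident by (intro PiM_cong) auto
      also have "distr M (Pi\<^sub>M ?I (\<lambda>_. borel)) W = distr M ?P W"
        by (intro distr_cong refl sets_PiM_cong) (simp_all add: PZ_sets)
      finally show ?thesis .
    qed
    have AE_N: "AE \<omega> in M. W \<omega> \<notin> N n"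
      using AE_not_in[OF N[OF n]] by (intro AE_distrD[OF W_meas]) (simp only: law)
    have e_bdd: "bdd_below (e \<omega> ` \<Theta>)" for \<omega>
    proof (rule bdd_belowI2)
      fix t assume t: "t \<in> \<Theta>"
      show "1 / real n * (\<Sum>j=1..n. - \<xi> (Z j \<omega>)) \<le> e \<omega> t"
        unfolding e_def using A2(4)[OF t] by (intro mult_left_mono sum_mono) (auto simp: abs_le_iff minus_le_iff)
    qed
    \<comment> \<open>The exceptional set does not depend on the parameter, so one null set serves
      all of \<open>\<Theta>\<close>. The identity for the means is deterministic, but
      \<open>A3\<close> delivers it at points outside \<open>N n\<close>, hence the common
      condition.\<close>
    have reduce: "(INF t\<in>\<Theta>. e \<omega> t) = (INF t\<in>D. e \<omega> t) \<and> (INF t\<in>\<Theta>. m t) = (INF t\<in>D. m t)"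
      if \<omega>: "\<omega> \<in> space M" "W \<omega> \<notin> N n" for \<omega>
    proof
      have dense_W: "(INF t'\<in>D. \<bar>m t' - m t\<bar>) = 0"
        "(INF t'\<in>D. Max ((\<lambda>j. \<bar>G t (Z j \<omega>) - G t' (Z j \<omega>)\<bar>) ` ?I)) = 0" if t: "t \<in> \<Theta>" for t
      proof -
        have "W \<omega> \<in> space ?P - N n"
          using \<omega> measurable_space[OF W_meas] by auto
        note * = dense[OF n t this]
        have "(INF t'\<in>D. \<bar>m t' - m t\<bar>) = (INF t'\<in>D. \<bar>(\<integral>\<omega>. G t' (Z 1 \<omega>) \<partial>M) - (\<integral>\<omega>. G t (Z 1 \<omega>) \<partial>M)\<bar>)"
          using D(3) mean t by (intro INF_cong refl) (auto simp: subset_iff)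
        then show "(INF t'\<in>D. \<bar>m t' - m t\<bar>) = 0"
          using * by simp
        have "Max ((\<lambda>j. \<bar>G t (Z j \<omega>) - G t' (Z j \<omega>)\<bar>) ` ?I) = Max ((\<lambda>j. \<bar>G t (W \<omega> j) - G t' (W \<omega> j)\<bar>) ` ?I)" for t'
          by (intro arg_cong[where f = Max] image_cong) (auto simp: W_def)
        then show "(INF t'\<in>D. Max ((\<lambda>j. \<bar>G t (Z j \<omega>) - G t' (Z j \<omega>)\<bar>) ` ?I)) = 0"
          using * by simp
      qed
      show "(INF t\<in>\<Theta>. m t) = (INF t\<in>D. m t)"
        using dense_W(1) by (intro cINF_eq_of_dense D m_bdd) (simp add: abs_minus_commute)
      show "(INF t\<in>\<Theta>. e \<omega> t) = (INF t\<in>D. e \<omega> t)"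
      proof (intro cINF_eq_of_dense D e_bdd)
        fix t assume t: "t \<in> \<Theta>"
        have le: "\<bar>e \<omega> t - e \<omega> t'\<bar> \<le> Max ((\<lambda>j. \<bar>G t (Z j \<omega>) - G t' (Z j \<omega>)\<bar>) ` ?I)" for t'
        proof -
          have "\<bar>\<Sum>j\<in>?I. G t (Z j \<omega>) - G t' (Z j \<omega>)\<bar>
              \<le> (\<Sum>j\<in>?I. Max ((\<lambda>j. \<bar>G t (Z j \<omega>) - G t' (Z j \<omega>)\<bar>) ` ?I))"
            by (intro order_trans[OF sum_abs] sum_mono Max_ge) auto
          moreover have "e \<omega> t - e \<omega> t' = (\<Sum>j\<in>?I. G t (Z j \<omega>) - G t' (Z j \<omega>)) / n"
            by (simp add: e_def sum_subtractf diff_divide_distrib)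
          ultimately show ?thesis
            using n by (simp add: divide_le_eq mult.commute)
        qed
        have "(INF t'\<in>D. \<bar>e \<omega> t - e \<omega> t'\<bar>) \<le> (INF t'\<in>D. Max ((\<lambda>j. \<bar>G t (Z j \<omega>) - G t' (Z j \<omega>)\<bar>) ` ?I))"
        proof (rule cINF_mono[OF D(2)])
          show "bdd_below ((\<lambda>t'. \<bar>e \<omega> t - e \<omega> t'\<bar>) ` D)"
            by (rule bdd_belowI2[of _ 0]) simp
        qed (use le in blast)
        moreover have "0 \<le> (INF t'\<in>D. \<bar>e \<omega> t - e \<omega> t'\<bar>)"
          using D(2) by (intro cINF_greatest) auto
        ultimately show "(INF t'\<in>D. \<bar>e \<omega> t - e \<omega> t'\<bar>) = 0"
          using dense_W(2)[OF t] by simp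
      qed
    qed
    have D_meas [measurable]: "G t \<in> borel_measurable borel" if "t \<in> D" for t
      using that D(3) A1 by auto
    have "X \<in> borel_measurable M"
    proof (rule cM.borel_measurable_AE_eq)
      show "AE \<omega> in M. X \<omega> = sqrt n * ((INF t\<in>D. e \<omega> t) - (INF t\<in>\<Theta>. m t))"
        using AE_N AE_space by eventually_elim (simp add: X_def reduce)
      show "(\<lambda>\<omega>. sqrt n * ((INF t\<in>D. e \<omega> t) - (INF t\<in>\<Theta>. m t))) \<in> borel_measurable M"
      proof -
        have "(\<lambda>\<omega>. e \<omega> t) \<in> borel_measurable M" if "t \<in> D" for t
          unfolding e_def using D_meas[OF that] Z
          by (intro borel_measurable_times borel_measurable_const borel_measurable_sum measurable_compose[of "Z _" M borel "G t"]) auto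
        then show ?thesis
          using D(1) by (intro borel_measurable_times borel_measurable_const borel_measurable_diff borel_measurable_cINF_real)
      qed
    qed
    moreover have "(\<integral>\<^sup>+ \<omega>. ennreal \<bar>X \<omega>\<bar> \<partial>M) \<le> ennreal B"
    proof -
      \<comment> \<open>\<open>S\<close> is a supremum of sums, \<open>n\<close> times that of the
        averages, whereas \<open>X\<close> carries only \<open>sqrt n\<close>; this leaves the
        factor \<open>sqrt n\<close> on the left. Where \<open>S\<close> is finite its value serves
        as the real constant in \<open>abs_cINF_diff_le\<close>.\<close>
      have "AE \<omega> in M. ennreal (sqrt n) * ennreal \<bar>X \<omega>\<bar> \<le> S (W \<omega>)"
        using AE_N AE_space
      proof eventually_elim
        case (elim \<omega>)
        show ?case
        proof (cases "S (W \<omega>) = \<infinity>")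
          case False
          then obtain s where s: "S (W \<omega>) = ennreal s" "s \<ge> 0"
            by (cases "S (W \<omega>)") auto
          have "\<bar>e \<omega> t - m t\<bar> \<le> s / n" if t: "t \<in> D" for t
          proof -
            have "ennreal \<bar>\<Sum>j\<in>?I. G t (W \<omega> j) - m t\<bar> \<le> ennreal s"
              unfolding s(1)[symmetric] S_def using t by (rule SUP_upper)
            then have "\<bar>\<Sum>j\<in>?I. G t (W \<omega> j) - m t\<bar> \<le> s"
              using s(2) by simp
            moreover have "(\<Sum>j\<in>?I. G t (W \<omega> j) - m t) = n * (e \<omega> t - m t)"
              using n by (simp add: e_def W_def sum_subtractf right_diff_distrib)
            ultimately have "\<bar>real n * (e \<omega> t - m t)\<bar> \<le> s"
              by (simp only:)
            then show ?thesis
              using n by (simp add: abs_mult pos_le_divide_eq mult.commute)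
          qed
          then have "\<bar>(INF t\<in>D. e \<omega> t) - (INF t\<in>D. m t)\<bar> \<le> s / n"
            using D e_bdd m_bdd by (intro abs_cINF_diff_le bdd_below_mono[OF e_bdd image_mono] bdd_below_mono[OF m_bdd image_mono])
          then have "sqrt n * (sqrt n * \<bar>(INF t\<in>D. e \<omega> t) - (INF t\<in>D. m t)\<bar>) \<le> s"
            using n by (simp add: mult.assoc[symmetric] field_simps)
          then have "sqrt n * \<bar>X \<omega>\<bar> \<le> s"
            using reduce[of \<omega>] elim by (simp add: X_def abs_mult)
          then show ?thesis
            using s by (simp add: ennreal_mult'[symmetric])
        qed simp
      qed
      then have "(\<integral>\<^sup>+ \<omega>. ennreal (sqrt n) * ennreal \<bar>X \<omega>\<bar> \<partial>M) \<le> (\<integral>\<^sup>+ \<omega>. S (W \<omega>) \<partial>M)"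
        by (rule nn_integral_mono_AE)
      also have "\<dots> = (\<integral>\<^sup>+ z. S z \<partial>distr M ?P W)"
      proof (rule nn_integral_distr[symmetric, OF W_meas])
        have "G t \<in> borel_measurable PZ" if "t \<in> D" for t
          using D_meas[OF that] measurable_cong_sets[OF PZ_sets refl, of borel] by auto
        then show "S \<in> borel_measurable (distr M ?P W)"
          unfolding law S_def by (intro borel_measurable_SUP_ennreal_abs D) auto
      qed
      also have "\<dots> \<le> ennreal (sqrt n * B)"
        unfolding law S_def m_def
        using expected_supremum_bound[OF PZ PZ_sets, of ?I D \<Theta> G \<xi>] assms D n by (simp add: B_def mult.assoc)
      \<comment> \<open>The remaining factor \<open>sqrt n\<close> is positive and finite, so it
        cancels and leaves the bound \<open>B\<close>, which is free of \<open>n\<close>.\<close>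
      finally have "ennreal (sqrt n) * (\<integral>\<^sup>+ \<omega>. ennreal \<bar>X \<omega>\<bar> \<partial>M) \<le> ennreal (sqrt n) * ennreal B"
        using \<open>X \<in> borel_measurable M\<close> by (simp add: nn_integral_cmult ennreal_mult')
      then show ?thesis
        using n by (subst (asm) ennreal_mult_le_mult_iff) auto
    qed
    moreover have "X = (\<lambda>\<omega>. sqrt (real n) * ((INF \<theta>\<in>\<Theta>. 1 / real n * (\<Sum>j=1..n. G \<theta> (Z j \<omega>)))
        - (INF \<theta>\<in>\<Theta>. \<integral>\<omega>'. G \<theta> (Z 1 \<omega>') \<partial>M)))"
      unfolding X_def e_def using mean by (simp cong: INF_cong)
    ultimately show ?thesis
      by simp
  qed
  show ?thesis
    unfolding Let_def
    by (rule M.uniformly_tight_of_bounded_L1[OF _ B]) (rule conjunct1[OF main] conjunct2[OF main], simp)+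
qed

end
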